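(* Let $\Delta$ be a simplicial complex on the vertex set $[n]=\{1,\ldots,n\}$ and let $K$ be a field. The following conditions are equivalent: (a) $\Delta$ is inseparable; (b) the graph $G_{\{i\}}(\Delta)$ is connected for $i=1,\ldots,n$; (c) $T^1(\Delta)_{-\mathbf e_i}=0$ for $i=1,\ldots,n$, where $\mathbf e_i$ denotes the $i$th canonical basis vector of $\mathbb Z^n$.
   Context: A simplicial complex $\Delta$ on $[n]$ is a collection of subsets of $[n]$ (faces) closed under taking subsets, with $\emptyset\in\Delta$; a vertex $i$ need not satisfy $\{i\}\in\Delta$. Let $S=K[x_1,\ldots,x_n]$. The Stanley--Reisner ideal $I_\Delta\subseteq S$ is generated by the monomials $x_N=\prod_{i\in N}x_i$ with $N\subseteq[n]$, $N\notin\Delta$, and $K[\Delta]=S/I_\Delta$. For an ideal $I\subseteq S$, $T^1(S/I)$ is the cokernel of $\delta^*:\mathrm{Der}_K(S)\to \mathrm{Hom}_S(I,S/I)$, $\delta^*(\partial)(f)=\partial f+I$. If $I$ is a monomial ideal, $T^1(S/I)$ is $\mathbb Z^n$-graded (with $\deg x_i=\mathbf e_i$; a homomorphism has degree $\mathbf c$ if it maps elements of degree $\mathbf a$ to elements of degree $\mathbf a+\mathbf c$). Put $T^1(\Delta)=T^1(K[\Delta])$. Separation: let $I\subseteq S$ be a squarefree monomial ideal and $y$ an indeterminate over $S$. A monomial ideal $J\subseteq S[y]$ is a separation of $I$ for the variable $x_i$ if (i) $I$ is the image of $J$ under the $K$-algebra homomorphism $S[y]\to S$ with $y\mapsto x_i$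 and $x_j\mapsto x_j$ for all $j$; (ii) $x_i$ divides some minimal monomial generator of $J$ and $y$ divides some minimal monomial generator of $J$; (iii) $y-x_i$ is a non-zero divisor on $S[y]/J$. $\Delta$ is separable if $I_\Delta$ admits a separation for some variable $x_i$, and inseparable otherwise. $G_{\{i\}}(\Delta)$ is the graph whose vertices are the faces $F\in\Delta$ with $i\notin F$ and $F\cup\{i\}\notin\Delta$, with $\{F,G\}$ an edge iff $F\subsetneq G$ or $G\subsetneq F$. A graph with no vertices is regarded as connected. *)

theory Defs
  imports
    "HOL-Library.Poly_Mapping"
    "HOL-Algebra.QuotRing"
    "HOL-Algebra.Divisibility"
    "HOL-Algebra.Module"
begin

section \<open>Polynomial rings over a field\<close>

text \<open>Polynomials are finitely supported functions from exponent vectors to coefficients, with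
  the convolution product of \<^theory>\<open>HOL-Library.Poly_Mapping\<close>. The variables are indexed by
  natural numbers. The field of coefficients is a type of class \<^class>\<open>field\<close>.\<close>

type_synonym 'k mpoly = "(nat \<Rightarrow>\<^sub>0 nat) \<Rightarrow>\<^sub>0 'k"

definition X :: "nat \<Rightarrow> 'k::field mpoly"
  where "X i = Poly_Mapping.single (Poly_Mapping.single i 1) 1"

definition Const :: "'k::field \<Rightarrow> 'k mpoly"
  where "Const c = Poly_Mapping.single 0 c"

text \<open>The ring \<open>K[x\<^sub>v | v \<in> V]\<close>.\<close>

definition poly_ring :: "nat set \<Rightarrow> 'k::field mpoly ring"
  where "poly_ring V =
    \<lparr>carrier = {p. \<forall>m\<in>Poly_Mapping.keys p. Poly_Mapping.keys m \<subseteq> V},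
     monoid.mult = (*), one = 1, zero = 0, add = (+)\<rparr>"

text \<open>The substitution homomorphism of \<open>K\<close>-algebras sending \<open>x\<^sub>j\<close> to \<open>\<sigma> j\<close>.\<close>

definition substitute :: "(nat \<Rightarrow> 'k::field mpoly) \<Rightarrow> 'k mpoly \<Rightarrow> 'k mpoly"
  where "substitute \<sigma> p =
    (\<Sum>m\<in>Poly_Mapping.keys p. Const (Poly_Mapping.lookup p m) *
      (\<Prod>j\<in>Poly_Mapping.keys m. \<sigma> j ^ Poly_Mapping.lookup m j))"

abbreviation poly_S :: "nat \<Rightarrow> 'k::field mpoly ring"
  where "poly_S n \<equiv> poly_ring {1..n}"

text \<open>In \<open>S[y]\<close> the additional indeterminate \<open>y\<close> is the variable with index \<open>0\<close>.\<close>

abbreviation poly_Sy :: "nat \<Rightarrow> 'k::field mpoly ring"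
  where "poly_Sy n \<equiv> poly_ring {0..n}"

abbreviation Y :: "'k::field mpoly"
  where "Y \<equiv> X 0"


section \<open>Monomial ideals\<close>

definition monomials :: "nat set \<Rightarrow> 'k::field mpoly set"
  where "monomials V = {Poly_Mapping.single m 1 | m. Poly_Mapping.keys m \<subseteq> V}"

definition monomial_ideal :: "nat set \<Rightarrow> 'k::field mpoly set \<Rightarrow> bool"
  where "monomial_ideal V J \<longleftrightarrow>
    ideal J (poly_ring V) \<and> (\<exists>M\<subseteq>monomials V. J = Idl\<^bsub>poly_ring V\<^esub> M)"

definition minimal_monomial_generators :: "nat set \<Rightarrow> 'k::field mpoly set \<Rightarrow> 'k mpoly set \<Rightarrow> bool"
  where "minimal_monomial_generators V J M \<longleftrightarrow>
    M \<subseteq> monomials V \<and> Idl\<^bsub>poly_ring V\<^esub> M = J \<and>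
    (\<forall>M'. M' \<subset> M \<longrightarrow> Idl\<^bsub>poly_ring V\<^esub> M' \<noteq> J)"

definition minimal_monomial_generator :: "nat set \<Rightarrow> 'k::field mpoly set \<Rightarrow> 'k mpoly \<Rightarrow> bool"
  where "minimal_monomial_generator V J u \<longleftrightarrow>
    (\<exists>M. minimal_monomial_generators V J M \<and> u \<in> M)"


section \<open>Simplicial complexes and Stanley--Reisner ideals\<close>

text \<open>A vertex \<open>i\<close> of \<open>{1..n}\<close> need not be a face \<open>{i}\<close>.\<close>

definition simplicial_complex :: "nat \<Rightarrow> nat set set \<Rightarrow> bool"
  where "simplicial_complex n \<Delta> \<longleftrightarrow>
    \<Delta> \<subseteq> Pow {1..n} \<and> {} \<in> \<Delta> \<and> (\<forall>F\<in>\<Delta>. \<forall>G. G \<subseteq> F \<longrightarrow> G \<in> \<Delta>)"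

definition SR_ideal :: "nat \<Rightarrow> nat set set \<Rightarrow> 'k::field mpoly set"
  where "SR_ideal n \<Delta> =
    Idl\<^bsub>poly_S n\<^esub> {\<Prod>i\<in>N. X i | N. N \<subseteq> {1..n} \<and> N \<notin> \<Delta>}"


section \<open>Separations\<close>

definition non_zero_divisor :: "('a, 'b) ring_scheme \<Rightarrow> 'a \<Rightarrow> bool"
  where "non_zero_divisor R a \<longleftrightarrow>
    (\<forall>b\<in>carrier R. a \<otimes>\<^bsub>R\<^esub> b = \<zero>\<^bsub>R\<^esub> \<longrightarrow> b = \<zero>\<^bsub>R\<^esub>)"

definition separation :: "nat \<Rightarrow> 'k::field mpoly set \<Rightarrow> nat \<Rightarrow> 'k mpoly set \<Rightarrow> bool"
  where "separation n I i J \<longleftrightarrow>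
    monomial_ideal {0..n} J \<and>
    substitute (\<lambda>j. if j = 0 then X i else X j) ` J = I \<and>
    (\<exists>u. minimal_monomial_generator {0..n} J u \<and> X i divides\<^bsub>poly_Sy n\<^esub> u) \<and>
    (\<exists>u. minimal_monomial_generator {0..n} J u \<and> Y divides\<^bsub>poly_Sy n\<^esub> u) \<and>
    non_zero_divisor (poly_Sy n Quot J) (J +>\<^bsub>poly_Sy n\<^esub> (Y - X i))"

text \<open>The type argument is the field \<open>K\<close>.\<close>

definition separable :: "'k::field itself \<Rightarrow> nat \<Rightarrow> nat set set \<Rightarrow> bool"
  where "separable K n \<Delta> \<longleftrightarrow>
    (\<exists>i\<in>{1..n}. \<exists>J. separation n (SR_ideal n \<Delta> :: 'k mpoly set) i J)"

definition inseparable :: "'k::field itself \<Rightarrow> nat \<Rightarrow> nat set set \<Rightarrow> bool"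
  where "inseparable K n \<Delta> \<longleftrightarrow> \<not> separable K n \<Delta>"


section \<open>The graphs \<open>G\<^bsub>{i}\<^esub>(\<Delta>)\<close>\<close>

text \<open>Graphs are pairs of a vertex set and a set of two-element edges. With the following
  definition the graph without vertices is connected.\<close>

definition graph_connected :: "'a set \<times> 'a set set \<Rightarrow> bool"
  where "graph_connected G \<longleftrightarrow>
    (\<forall>u\<in>fst G. \<forall>v\<in>fst G. (u, v) \<in> {(a, b). {a, b} \<in> snd G}\<^sup>*)"

definition G_vertices :: "nat \<Rightarrow> nat set set \<Rightarrow> nat set set"
  where "G_vertices i \<Delta> = {F \<in> \<Delta>. i \<notin> F \<and> F \<union> {i} \<notin> \<Delta>}"

definition G_graph :: "nat \<Rightarrow> nat set set \<Rightarrow> nat set set \<times> nat set set set"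
  where "G_graph i \<Delta> =
    (G_vertices i \<Delta>,
     {{F, G} | F G. F \<in> G_vertices i \<Delta> \<and> G \<in> G_vertices i \<Delta> \<and> (F \<subset> G \<or> G \<subset> F)})"


section \<open>The cotangent cohomology module \<open>T\<^sup>1\<close>\<close>

text \<open>Derivations of \<open>S\<close> over \<open>K\<close>.\<close>

definition Der :: "nat \<Rightarrow> ('k::field mpoly \<Rightarrow> 'k mpoly) set"
  where "Der n =
    {D \<in> carrier (poly_S n) \<rightarrow>\<^sub>E carrier (poly_S n).
      (\<forall>f\<in>carrier (poly_S n). \<forall>g\<in>carrier (poly_S n). D (f + g) = D f + D g) \<and>
      (\<forall>c. \<forall>f\<in>carrier (poly_S n). D (Const c * f) = Const c * D f) \<and>
      (\<forall>f\<in>carrier (poly_S n). \<forall>g\<in>carrier (poly_S n). D (f * g) = f * D g + g * D f)}"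

text \<open>The set of \<open>S\<close>-linear maps from \<open>I\<close> to \<open>S/I\<close>; a scalar \<open>s\<close> acts on \<open>S/I\<close> as
  multiplication by its coset.\<close>

definition Hom_carrier ::
    "nat \<Rightarrow> 'k::field mpoly set \<Rightarrow> ('k mpoly \<Rightarrow> 'k mpoly set) set"
  where "Hom_carrier n I =
    {\<phi> \<in> I \<rightarrow>\<^sub>E carrier (poly_S n Quot I).
      (\<forall>f\<in>I. \<forall>g\<in>I. \<phi> (f + g) = \<phi> f \<oplus>\<^bsub>poly_S n Quot I\<^esub> \<phi> g) \<and>
      (\<forall>s\<in>carrier (poly_S n). \<forall>f\<in>I.
        \<phi> (s * f) = (I +>\<^bsub>poly_S n\<^esub> s) \<otimes>\<^bsub>poly_S n Quot I\<^esub> \<phi> f)}"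

text \<open>Records of type \<open>module\<close> extend ring records; the fields \<open>mult\<close> and \<open>one\<close>
  have no meaning for a module.\<close>

definition Hom_module ::
    "nat \<Rightarrow> 'k::field mpoly set \<Rightarrow> ('k mpoly, 'k mpoly \<Rightarrow> 'k mpoly set) module"
  where "Hom_module n I =
    \<lparr>carrier = Hom_carrier n I, monoid.mult = undefined, one = undefined,
     zero = (\<lambda>f\<in>I. \<zero>\<^bsub>poly_S n Quot I\<^esub>),
     add = (\<lambda>\<phi> \<psi>. \<lambda>f\<in>I. \<phi> f \<oplus>\<^bsub>poly_S n Quot I\<^esub> \<psi> f),
     smult = (\<lambda>s \<phi>. \<lambda>f\<in>I. (I +>\<^bsub>poly_S n\<^esub> s) \<otimes>\<^bsub>poly_S n Quot I\<^esub> \<phi> f)\<rparr>"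

definition quotient_module :: "('a, 'b, 'c) module_scheme \<Rightarrow> 'b set \<Rightarrow> ('a, 'b set) module"
  where "quotient_module M B =
    \<lparr>carrier = a_rcosets\<^bsub>M\<^esub> B, monoid.mult = undefined, one = undefined,
     zero = B, add = set_add M,
     smult = (\<lambda>s C. \<Union>\<phi>\<in>C. B +>\<^bsub>M\<^esub> (s \<odot>\<^bsub>M\<^esub> \<phi>))\<rparr>"

definition delta_star ::
    "nat \<Rightarrow> 'k::field mpoly set \<Rightarrow> ('k mpoly \<Rightarrow> 'k mpoly) \<Rightarrow> ('k mpoly \<Rightarrow> 'k mpoly set)"
  where "delta_star n I D = (\<lambda>f\<in>I. I +>\<^bsub>poly_S n\<^esub> D f)"

definition T1 ::
    "nat \<Rightarrow> 'k::field mpoly set \<Rightarrow> ('k mpoly, ('k mpoly \<Rightarrow> 'k mpoly set) set) module"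
  where "T1 n I = quotient_module (Hom_module n I) (delta_star n I ` Der n)"

text \<open>Elements of \<open>\<int>\<^sup>n\<close> are functions of which only the values on \<open>{1..n}\<close> matter.
  The component in a degree with a negative entry is \<open>{0}\<close>.\<close>

definition S_component :: "nat \<Rightarrow> (nat \<Rightarrow> int) \<Rightarrow> 'k::field mpoly set"
  where "S_component n a =
    {f \<in> carrier (poly_S n).
      \<forall>m\<in>Poly_Mapping.keys f. \<forall>j\<in>{1..n}. int (Poly_Mapping.lookup m j) = a j}"

definition Quot_component ::
    "nat \<Rightarrow> 'k::field mpoly set \<Rightarrow> (nat \<Rightarrow> int) \<Rightarrow> 'k mpoly set set"
  where "Quot_component n I a = (\<lambda>f. I +>\<^bsub>poly_S n\<^esub> f) ` S_component n a"

definition Hom_component ::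
    "nat \<Rightarrow> 'k::field mpoly set \<Rightarrow> (nat \<Rightarrow> int) \<Rightarrow> ('k mpoly \<Rightarrow> 'k mpoly set) set"
  where "Hom_component n I c =
    {\<phi> \<in> Hom_carrier n I.
      \<forall>a. \<forall>f\<in>I \<inter> S_component n a. \<phi> f \<in> Quot_component n I (\<lambda>j. a j + c j)}"

text \<open>The grading of the cokernel is the one induced from \<open>Hom\<^sub>S(I, S/I)\<close>.\<close>

definition T1_component ::
    "nat \<Rightarrow> 'k::field mpoly set \<Rightarrow> (nat \<Rightarrow> int) \<Rightarrow> ('k mpoly \<Rightarrow> 'k mpoly set) set set"
  where "T1_component n I c =
    (\<lambda>\<phi>. (delta_star n I ` Der n) +>\<^bsub>Hom_module n I\<^esub> \<phi>) ` Hom_component n I c"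

definition unit_vec :: "nat \<Rightarrow> nat \<Rightarrow> int"
  where "unit_vec i = (\<lambda>j. if j = i then 1 else 0)"

end

theory Submission
  imports Defs
begin

text \<open>A monomial ideal corresponds to an upward closed set \<open>E\<close> of exponents. If \<open>y - x\<^sub>i\<close> is a
  non-zero divisor modulo a monomial ideal \<open>J\<close> specializing to \<open>I\<^sub>\<Delta>\<close>, then for each vertex \<open>F\<close> of
  \<open>G\<^bsub>{i}\<^esub>(\<Delta>)\<close> exactly one of \<open>x\<^sub>i * x\<^sub>F\<close> and \<open>y * x\<^sub>F\<close> lies in \<open>J\<close>. As \<open>J\<close> is an ideal, the choice is constant
  along edges; if the graph is connected, then one of \<open>x\<^sub>i\<close> and \<open>y\<close> occurs in no minimal
  generator of \<open>J\<close>. Conversely, a partition of the graph into two nonempty parts without edges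
  between them yields a separation, in which \<open>x\<^sub>i * x\<^sub>F\<close> is replaced by \<open>y * x\<^sub>F\<close> for \<open>F\<close> in the second part.

  A homomorphism \<open>I\<^sub>\<Delta> \<rightarrow> K[\<Delta>]\<close> of degree \<open>-\<epsilon>\<^sub>i\<close> maps \<open>x\<^sub>i * x\<^sub>F\<close> to \<open>c\<^sub>F * x\<^sub>F\<close> and is determined by the function
  \<open>F \<mapsto> c\<^sub>F\<close> on the vertices of the graph; the functions that occur are those which are constant along
  edges. The image of \<open>\<delta>\<^sup>*\<close> consists of the constant functions, since \<open>\<partial>/\<partial>x\<^sub>i\<close> gives \<open>c\<^sub>F = 1\<close> for all \<open>F\<close>.\<close>

section \<open>Monomial ideals and exponent sets\<close>

definition exps :: "nat set \<Rightarrow> (nat \<Rightarrow>\<^sub>0 nat) set"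
  where "exps V = {m. Poly_Mapping.keys m \<subseteq> V}"

text \<open>The span of the monomials with exponents in \<open>E\<close>. Polynomial rings and
  monomial ideals are all of this form, which turns questions about ideals into questions about sets
  of exponents.\<close>

definition polys :: "'a set \<Rightarrow> ('a \<Rightarrow>\<^sub>0 'b::zero) set"
  where "polys E = {p. Poly_Mapping.keys p \<subseteq> E}"

definition up_closed :: "nat set \<Rightarrow> (nat \<Rightarrow>\<^sub>0 nat) set \<Rightarrow> bool"
  where "up_closed V E \<longleftrightarrow> E \<subseteq> exps V \<and> (\<forall>a\<in>E. \<forall>d\<in>exps V. a + d \<in> E)"

definition upset :: "nat set \<Rightarrow> (nat \<Rightarrow>\<^sub>0 nat) set \<Rightarrow> (nat \<Rightarrow>\<^sub>0 nat) set"
  where "upset V E = {e + d | e d. e \<in> E \<and> d \<in> exps V}"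

section \<open>Supports of exponents and coefficients of products with a term\<close>

lemma keys_add_nat: "Poly_Mapping.keys (a + b :: 'a \<Rightarrow>\<^sub>0 nat) = Poly_Mapping.keys a \<union> Poly_Mapping.keys b"
  by (auto simp: in_keys_iff lookup_add)


text \<open>Reduces statements that are additive in \<open>f\<close> to single terms. Keeping all
  exponents in \<open>A\<close> lets the induction run inside an ideal.\<close>

lemma poly_keys_induct [consumes 1, case_names zero add]:
  fixes f :: "'a \<Rightarrow>\<^sub>0 'b::comm_monoid_add"
  assumes "f \<in> polys A" and "P 0"
    and step: "\<And>m c f. m \<in> A \<Longrightarrow> f \<in> polys A \<Longrightarrow> P f \<Longrightarrow> P (Poly_Mapping.single m c + f)"
  shows "P f"
proof -
  have "f \<in> polys A \<longrightarrow> P f"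
  proof (induction f rule: update_induct)
    case const
    show ?case using assms(2) by simp
  next
    case (update f a b)
    have eq: "Poly_Mapping.update a b f = Poly_Mapping.single a b + f"
      using update(1)
      by (intro poly_mapping_eqI) (auto simp: lookup_update lookup_add lookup_single when_def in_keys_iff)
    show ?case
    proof
      assume "Poly_Mapping.update a b f \<in> polys A"
      hence "a \<in> A" "f \<in> polys A"
        using update(1,2) by (auto simp: polys_def keys_update)
      thus "P (Poly_Mapping.update a b f)" unfolding eq using update(3) step by blast
    qed
  qed
  thus ?thesis using assms(1) by blast
qed

text \<open>Multiplication by a term translates exponents; addition of exponents is cancellative, so
  only the coefficient of \<open>f\<close> at \<open>k\<close> contributes.\<close>

lemma lookup_single_times_add:
  fixes f :: "'a::cancel_comm_monoid_add \<Rightarrow>\<^sub>0 'b::comm_semiring_1"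
  shows "Poly_Mapping.lookup (Poly_Mapping.single b c * f) (b + k) = c * Poly_Mapping.lookup f k"
proof -
  have "f \<in> polys UNIV" by (simp add: polys_def)
  thus ?thesis
    by (induction f rule: poly_keys_induct)
       (auto simp: distrib_left lookup_add mult_single lookup_single when_def)
qed

lemma lookup_single_times_0:
  fixes f :: "'a::cancel_comm_monoid_add \<Rightarrow>\<^sub>0 'b::comm_semiring_1"
  assumes "\<nexists>d. k = b + d"
  shows "Poly_Mapping.lookup (Poly_Mapping.single b c * f) k = 0"
proof -
  have "f \<in> polys UNIV" by (simp add: polys_def)
  thus ?thesis
    using assms by (induction f rule: poly_keys_induct)
       (auto simp: distrib_left lookup_add mult_single lookup_single when_def)
qed

section \<open>Polynomial rings and monomial ideals as spans of monomials\<close>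

lemma poly_ring_simps [simp]:
  "carrier (poly_ring V) = polys (exps V)"
  "f \<otimes>\<^bsub>poly_ring V\<^esub> g = f * g"
  "\<one>\<^bsub>poly_ring V\<^esub> = 1"
  "\<zero>\<^bsub>poly_ring V\<^esub> = 0"
  "f \<oplus>\<^bsub>poly_ring V\<^esub> g = f + g"
  by (auto simp: poly_ring_def polys_def exps_def)

lemma polys_zero [simp]: "0 \<in> polys E"
  by (simp add: polys_def)

lemma polys_add: "f \<in> polys E \<Longrightarrow> g \<in> polys E \<Longrightarrow> f + g \<in> polys E"
  using keys_add[of f g] by (auto simp: polys_def)

lemma polys_uminus: "(f :: 'a \<Rightarrow>\<^sub>0 'b::ab_group_add) \<in> polys E \<Longrightarrow> - f \<in> polys E"
  by (auto simp: polys_def in_keys_iff)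

lemma polys_diff: "(f :: 'a \<Rightarrow>\<^sub>0 'b::ab_group_add) \<in> polys E \<Longrightarrow> g \<in> polys E \<Longrightarrow> f - g \<in> polys E"
  using polys_add[of f E "- g"] polys_uminus by auto

lemma single_in_polys: "m \<in> E \<Longrightarrow> Poly_Mapping.single m c \<in> polys E"
  by (auto simp: polys_def)

lemma single_in_polys_iff: "Poly_Mapping.single m c \<in> polys E \<longleftrightarrow> c = 0 \<or> m \<in> E"
  by (auto simp: polys_def)

lemma polys_mono: "E \<subseteq> E' \<Longrightarrow> polys E \<subseteq> polys E'"
  by (auto simp: polys_def)

lemma polys_mult:
  assumes "\<And>a b. a \<in> A \<Longrightarrow> b \<in> B \<Longrightarrow> a + b \<in> C" "f \<in> polys A" "g \<in> polys B"
  shows "f * g \<in> polys C"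
  using keys_mult[of f g] assms by (fastforce simp: polys_def)

lemma exps_add: "a \<in> exps V \<Longrightarrow> b \<in> exps V \<Longrightarrow> a + b \<in> exps V"
  by (auto simp: exps_def keys_add_nat)

lemma exps_add_iff: "a + b \<in> exps V \<longleftrightarrow> a \<in> exps V \<and> b \<in> exps V"
  by (auto simp: exps_def keys_add_nat)

lemma zero_exps [simp]: "0 \<in> exps V"
  by (simp add: exps_def)

text \<open>The ring laws hold for all polynomials; what remains is the closure of
  \<open>polys (exps V)\<close> under the operations.\<close>

lemma cring_poly_ring: "cring (poly_ring V :: 'k::field mpoly ring)"
proof (rule cringI)
  show "abelian_group (poly_ring V :: 'k mpoly ring)"
  proof (rule abelian_groupI)
    fix x :: "'k mpoly" assume "x \<in> carrier (poly_ring V)"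
    thus "\<exists>y\<in>carrier (poly_ring V). y \<oplus>\<^bsub>poly_ring V\<^esub> x = \<zero>\<^bsub>poly_ring V\<^esub>"
      by (intro bexI[of _ "- x"]) (auto intro: polys_uminus)
  qed (auto intro: polys_add simp: algebra_simps)
  show "Group.comm_monoid (poly_ring V :: 'k mpoly ring)"
  proof (rule comm_monoidI)
    show "\<one>\<^bsub>poly_ring V\<^esub> \<in> carrier (poly_ring V :: 'k mpoly ring)"
      by (auto simp: polys_def)
  qed (auto intro: polys_mult[OF exps_add] simp: algebra_simps)
qed (auto simp: algebra_simps)

lemma polys_exps_mult:
  fixes f g :: "'k::field mpoly"
  shows "f \<in> polys (exps V) \<Longrightarrow> g \<in> polys (exps V) \<Longrightarrow> f * g \<in> polys (exps V)"
  by (rule polys_mult[OF exps_add])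

lemma Const_mult_in_polys_exps:
  fixes f :: "'k::field mpoly"
  shows "f \<in> polys (exps V) \<Longrightarrow> Const c * f \<in> polys (exps V)"
  unfolding Const_def by (rule polys_exps_mult[OF single_in_polys[OF zero_exps]])

lemma a_inv_poly_ring:
  assumes "f \<in> polys (exps V)"
  shows "\<ominus>\<^bsub>poly_ring V\<^esub> f = - (f :: 'k::field mpoly)"
proof -
  interpret cring "poly_ring V :: 'k mpoly ring" by (rule cring_poly_ring)
  show ?thesis
    using assms by (intro minus_equality) (auto intro: polys_uminus)
qed

lemma polys_ideal:
  assumes "up_closed V E"
  shows "ideal (polys E :: 'k::field mpoly set) (poly_ring V)"
proof -
  interpret cring "poly_ring V :: 'k mpoly ring" by (rule cring_poly_ring)
  have sub: "polys E \<subseteq> (polys (exps V) :: 'k mpoly set)"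
    using assms by (intro polys_mono) (auto simp: up_closed_def)
  have "additive_subgroup (polys E :: 'k mpoly set) (poly_ring V)"
  proof (intro additive_subgroup.intro add.subgroupI)
    fix a :: "'k mpoly" assume a: "a \<in> polys E"
    thus "\<ominus>\<^bsub>poly_ring V\<^esub> a \<in> polys E"
      using sub a_inv_poly_ring[of a V] polys_uminus[OF a] by auto
  qed (use sub in \<open>auto intro: polys_add polys_zero\<close>)
  moreover have "a * x \<in> polys E" if "a \<in> polys E" "x \<in> polys (exps V)" for a x :: "'k mpoly"
    using assms by (intro polys_mult[OF _ that]) (auto simp: up_closed_def)
  ultimately show ?thesis
    by (intro idealI) (auto simp: additive_subgroup_def ring_axioms mult.commute)
qed

lemma up_closed_upset: "E \<subseteq> exps V \<Longrightarrow> up_closed V (upset V E)"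
  by (force simp: up_closed_def upset_def exps_add_iff add.assoc)

lemma upset_superset: "E \<subseteq> upset V E"
  unfolding upset_def by force

lemma upset_up_closed: "up_closed V E \<Longrightarrow> upset V E = E"
  using upset_superset[of E V] by (auto simp: upset_def up_closed_def)

text \<open>The right-hand side is an ideal containing the generators, hence contains the ideal
  generated by them. Conversely, each of its terms is a multiple of a generator.\<close>

lemma Idl_monomials:
  assumes "E \<subseteq> exps V"
  shows "Idl\<^bsub>poly_ring V\<^esub> ((\<lambda>m. Poly_Mapping.single m 1) ` E) = (polys (upset V E) :: 'k::field mpoly set)"
    (is "Idl\<^bsub>?R\<^esub> ?M = _")
proof
  interpret cring "poly_ring V :: 'k mpoly ring" by (rule cring_poly_ring)
  have id: "ideal (polys (upset V E) :: 'k mpoly set) ?R"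
    by (rule polys_ideal[OF up_closed_upset[OF assms]])
  show "Idl\<^bsub>?R\<^esub> ?M \<subseteq> polys (upset V E)"
    using upset_superset[of E V] by (intro genideal_minimal[OF id]) (auto simp: polys_def)
  have M: "?M \<subseteq> carrier ?R" using assms by (auto simp: polys_def)
  interpret I: ideal "Idl\<^bsub>?R\<^esub> ?M" ?R
    by (rule genideal_ideal[OF M])
  show "polys (upset V E) \<subseteq> Idl\<^bsub>?R\<^esub> ?M"
  proof
    fix f :: "'k mpoly" assume "f \<in> polys (upset V E)"
    thus "f \<in> Idl\<^bsub>?R\<^esub> ?M"
    proof (induction f rule: poly_keys_induct)
      case zero
      show ?case using I.zero_closed by simp
    next
      case (add m c f)
      obtain e d where m: "m = e + d" "e \<in> E" "d \<in> exps V" using add(1) by (auto simp: upset_def)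
      have "Poly_Mapping.single e 1 \<in> Idl\<^bsub>?R\<^esub> ?M"
        using genideal_self[OF M] m by auto
      from I.I_l_closed[OF this, of "Poly_Mapping.single d c"]
      have "Poly_Mapping.single m c \<in> Idl\<^bsub>?R\<^esub> ?M"
        using m by (simp add: mult_single add.commute single_in_polys)
      thus ?case using I.a_closed[OF _ add(3)] by simp
    qed
  qed
qed

lemma single_one_inject:
  "Poly_Mapping.single a (1 :: 'b::zero_neq_one) = Poly_Mapping.single b 1 \<Longrightarrow> a = b"
  by (metis lookup_single_eq lookup_single_not_eq zero_neq_one)

lemma polys_eq_iff: "(polys A :: ('a \<Rightarrow>\<^sub>0 'b::zero_neq_one) set) = polys B \<longleftrightarrow> A = B"
proof
  assume eq: "(polys A :: ('a \<Rightarrow>\<^sub>0 'b) set) = polys B"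
  have "m \<in> A \<longleftrightarrow> m \<in> B" for m
    using single_in_polys_iff[of m "1 :: 'b"] eq by (metis zero_neq_one)
  thus "A = B" by blast
qed simp

lemma monomials_eq: "monomials V = (\<lambda>m. Poly_Mapping.single m 1) ` exps V"
  by (auto simp: monomials_def exps_def)

text \<open>The dictionary between ideals and exponents; by \<open>polys_eq_iff\<close> the set
  \<open>E\<close> is determined by \<open>J\<close>.\<close>

lemma monomial_ideal_iff:
  "monomial_ideal V (J :: 'k::field mpoly set) \<longleftrightarrow> (\<exists>E. up_closed V E \<and> J = polys E)"
proof
  assume "monomial_ideal V J"
  then obtain M where M: "M \<subseteq> monomials V" "J = Idl\<^bsub>poly_ring V\<^esub> M"
    by (auto simp: monomial_ideal_def)
  then obtain E where "E \<subseteq> exps V" "M = (\<lambda>m. Poly_Mapping.single m 1) ` E"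
    unfolding monomials_eq by (meson subset_imageE)
  thus "\<exists>E. up_closed V E \<and> J = polys E"
    using M Idl_monomials up_closed_upset by blast
next
  assume "\<exists>E. up_closed V E \<and> J = polys E"
  then obtain E where E: "up_closed V E" "J = polys E" by blast
  hence "J = Idl\<^bsub>poly_ring V\<^esub> ((\<lambda>m. Poly_Mapping.single m 1) ` E)"
    using Idl_monomials[of E V] upset_up_closed[of V E] by (auto simp: up_closed_def)
  thus "monomial_ideal V J"
    unfolding monomial_ideal_def monomials_eq using E polys_ideal
    by (metis image_mono up_closed_def)
qed

section \<open>Minimal monomial generators\<close>

definition min_exps :: "(nat \<Rightarrow>\<^sub>0 nat) set \<Rightarrow> (nat \<Rightarrow>\<^sub>0 nat) set"
  where "min_exps E = {m \<in> E. \<forall>a\<in>E. \<forall>d. m = a + d \<longrightarrow> d = 0}"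

text \<open>Additivity of the total degree, the measure for the descent in
  \<open>min_exps_below\<close>.\<close>

lemma sum_lookup_add:
  fixes a d :: "'a \<Rightarrow>\<^sub>0 nat"
  shows "(\<Sum>j\<in>Poly_Mapping.keys (a + d). Poly_Mapping.lookup (a + d) j) =
    (\<Sum>j\<in>Poly_Mapping.keys a. Poly_Mapping.lookup a j) + (\<Sum>j\<in>Poly_Mapping.keys d. Poly_Mapping.lookup d j)"
proof -
  have *: "(\<Sum>j\<in>Poly_Mapping.keys a. Poly_Mapping.lookup a j) = (\<Sum>j\<in>K. Poly_Mapping.lookup a j)"
    if "finite K" "Poly_Mapping.keys a \<subseteq> K" for K and a :: "'a \<Rightarrow>\<^sub>0 nat"
    using that by (intro sum.mono_neutral_left) (auto simp: in_keys_iff)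
  show ?thesis
    by (subst (1 2 3) *[of "Poly_Mapping.keys (a + d)"]) (auto simp: keys_add_nat lookup_add sum.distrib)
qed

text \<open>A proper divisor has smaller total degree, so passing to proper divisors in
  \<open>E\<close> ends at a minimal exponent.\<close>

lemma min_exps_below:
  assumes "m \<in> E"
  shows "\<exists>a\<in>min_exps E. \<exists>d. m = a + d"
  using assms
proof (induction "\<Sum>j\<in>Poly_Mapping.keys m. Poly_Mapping.lookup m j" arbitrary: m rule: less_induct)
  case less
  show ?case
  proof (cases "m \<in> min_exps E")
    case True
    thus ?thesis by (intro bexI[of _ m] exI[of _ 0]) auto
  next
    case False
    then obtain a d where ad: "a \<in> E" "m = a + d" "d \<noteq> 0"
      using less(2) by (auto simp: min_exps_def)
    then obtain j where "j \<in> Poly_Mapping.keys d" by fastforce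
    hence "0 < (\<Sum>j\<in>Poly_Mapping.keys d. Poly_Mapping.lookup d j)"
      by (intro sum_pos2[of _ j]) (auto simp: in_keys_iff)
    with less(1)[of a] ad sum_lookup_add[of a d]
    obtain b e where "b \<in> min_exps E" "a = b + e" by auto
    thus ?thesis using ad by (auto simp: add.assoc)
  qed
qed

lemma add_eq_self_exp:
  fixes a b c :: "nat \<Rightarrow>\<^sub>0 nat"
  assumes "a = a + b + c"
  shows "b = 0" "c = 0"
proof -
  have "Poly_Mapping.lookup b j = 0 \<and> Poly_Mapping.lookup c j = 0" for j
    using assms by (metis add_cancel_right_right add.assoc add_is_0 lookup_add)
  thus "b = 0" "c = 0" by (auto intro: poly_mapping_eqI)
qed

lemma minimal_monomial_generator_iff:
  assumes E: "up_closed V E"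
  shows "minimal_monomial_generator V (polys E :: 'k::field mpoly set) u \<longleftrightarrow>
    (\<exists>m\<in>min_exps E. u = Poly_Mapping.single m 1)"
proof
  assume "minimal_monomial_generator V (polys E) u"
  then obtain M where M: "M \<subseteq> monomials V" "Idl\<^bsub>poly_ring V\<^esub> M = polys E"
      "\<And>M'. M' \<subset> M \<Longrightarrow> Idl\<^bsub>poly_ring V\<^esub> M' \<noteq> polys E" and u: "u \<in> M"
    by (auto simp: minimal_monomial_generator_def minimal_monomial_generators_def)
  then obtain E0 where E0: "E0 \<subseteq> exps V" "M = (\<lambda>m. Poly_Mapping.single m 1) ` E0"
    unfolding monomials_eq by (meson subset_imageE)
  then obtain m where m: "m \<in> E0" "u = Poly_Mapping.single m 1" using u by auto
  have EE: "upset V E0 = E"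
    using M(2) E0 Idl_monomials[OF E0(1), where ?'k = 'k] polys_eq_iff by metis
  have "d = 0" if a: "a \<in> E" "m = a + d" for a d
  proof (rule ccontr)
    assume "d \<noteq> 0"
    obtain e d' where e: "e \<in> E0" "a = e + d'" "d' \<in> exps V" using a EE by (auto simp: upset_def)
    \<comment> \<open>If \<open>e = m\<close>, then \<open>m = m + d' + d\<close> forces
      \<open>d = 0\<close>.\<close>
    have "e \<noteq> m" using \<open>d \<noteq> 0\<close> a e add_eq_self_exp(2)[of m d' d] by auto
    have "d' + d \<in> exps V" using m E0 a e by (auto simp: exps_add_iff)
    let ?E' = "E0 - {m}"
    have "x \<in> upset V ?E'" if x: "x \<in> upset V E0" for x
    proof -
      obtain y z where y: "y \<in> E0" "x = y + z" "z \<in> exps V" using x by (auto simp: upset_def)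
      show ?thesis
      proof (cases "y = m")
        case True
        hence "x = e + (d' + d + z)" "d' + d + z \<in> exps V" using y a e \<open>d' + d \<in> exps V\<close>
          by (auto simp: algebra_simps exps_add_iff)
        thus ?thesis using e \<open>e \<noteq> m\<close> unfolding upset_def by blast
      next
        case False
        thus ?thesis using y unfolding upset_def by blast
      qed
    qed
    hence "upset V ?E' = E" using EE unfolding upset_def by blast
    hence "Idl\<^bsub>poly_ring V\<^esub> ((\<lambda>m. Poly_Mapping.single m 1) ` ?E') = (polys E :: 'k mpoly set)"
      using Idl_monomials[of ?E' V] E0 by auto
    moreover have "(\<lambda>m. Poly_Mapping.single m (1::'k)) ` ?E' \<subset> M"
      unfolding E0(2) using m by (auto dest: single_one_inject)
    ultimately show False using M(3) by blast
  qed
  moreover have "m \<in> E" using EE m upset_superset by blast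
  ultimately show "\<exists>m\<in>min_exps E. u = Poly_Mapping.single m 1"
    using m by (auto simp: min_exps_def)
next
  assume "\<exists>m\<in>min_exps E. u = Poly_Mapping.single m 1"
  then obtain m where m: "m \<in> min_exps E" "u = Poly_Mapping.single m 1" by blast
  have EV: "E \<subseteq> exps V" using E by (auto simp: up_closed_def)
  hence min_V: "min_exps E \<subseteq> exps V" by (auto simp: min_exps_def)
  have "upset V (min_exps E) \<subseteq> E"
    using E by (auto simp: upset_def up_closed_def min_exps_def)
  moreover have "E \<subseteq> upset V (min_exps E)"
  proof
    fix m assume "m \<in> E"
    then obtain a d where "a \<in> min_exps E" "m = a + d" using min_exps_below by blast
    moreover from this have "d \<in> exps V" using EV \<open>m \<in> E\<close> by (auto simp: exps_add_iff)
    ultimately show "m \<in> upset V (min_exps E)" unfolding upset_def by blast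
  qed
  ultimately have up: "upset V (min_exps E) = E" by blast
  have "minimal_monomial_generators V (polys E :: 'k mpoly set) ((\<lambda>m. Poly_Mapping.single m 1) ` min_exps E)"
    unfolding minimal_monomial_generators_def
  proof (intro conjI allI impI)
    show "Idl\<^bsub>poly_ring V\<^esub> ((\<lambda>m. Poly_Mapping.single m 1) ` min_exps E) = (polys E :: 'k mpoly set)"
      using Idl_monomials[OF min_V] up by simp
    fix M' assume M': "M' \<subset> (\<lambda>m. Poly_Mapping.single m (1::'k)) ` min_exps E"
    then obtain E' where E': "E' \<subseteq> min_exps E" "M' = (\<lambda>m. Poly_Mapping.single m 1) ` E'"
      by (meson psubset_imp_subset subset_imageE)
    then obtain x where x: "x \<in> min_exps E" "x \<notin> E'" using M' by blast
    have "x \<notin> upset V E'"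
    proof
      assume "x \<in> upset V E'"
      then obtain e d where "e \<in> E'" "x = e + d" by (auto simp: upset_def)
      moreover from this have "e \<in> E" using E'(1) by (auto simp: min_exps_def)
      ultimately have "d = 0" using x(1) by (auto simp: min_exps_def)
      thus False using x(2) \<open>e \<in> E'\<close> \<open>x = e + d\<close> by simp
    qed
    hence "upset V E' \<noteq> E" using x by (auto simp: min_exps_def)
    hence "polys (upset V E') \<noteq> (polys E :: 'k mpoly set)" by (simp add: polys_eq_iff)
    moreover have "E' \<subseteq> exps V" using E' min_V by blast
    ultimately show "Idl\<^bsub>poly_ring V\<^esub> M' \<noteq> polys E"
      unfolding E'(2) by (simp add: Idl_monomials)
  qed (use min_V in \<open>auto simp: monomials_eq\<close>)
  thus "minimal_monomial_generator V (polys E) u"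
    using m by (auto simp: minimal_monomial_generator_def)
qed

text \<open>The cofactor is not known to be a monomial; comparing coefficients at \<open>m\<close>
  still shows that \<open>x_i\<close> occurs in \<open>m\<close>.\<close>

lemma X_divides_single_iff:
  assumes "m \<in> exps V" "i \<in> V"
  shows "X i divides\<^bsub>poly_ring V\<^esub> (Poly_Mapping.single m 1 :: 'k::field mpoly) \<longleftrightarrow>
    i \<in> Poly_Mapping.keys m"
proof
  assume "X i divides\<^bsub>poly_ring V\<^esub> (Poly_Mapping.single m 1 :: 'k mpoly)"
  then obtain f where "(Poly_Mapping.single m 1 :: 'k mpoly) = X i * f"
    by (auto simp: factor_def)
  hence "Poly_Mapping.lookup (X i * f) m = 1" by (metis lookup_single_eq)
  then obtain d where "m = Poly_Mapping.single i 1 + d"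
    unfolding X_def using lookup_single_times_0 by (metis zero_neq_one)
  thus "i \<in> Poly_Mapping.keys m" by (auto simp: keys_add_nat)
next
  assume i: "i \<in> Poly_Mapping.keys m"
  let ?d = "m - Poly_Mapping.single i 1"
  have eq: "m = Poly_Mapping.single i 1 + ?d"
    using i by (intro poly_mapping_eqI) (auto simp: lookup_add lookup_minus lookup_single when_def in_keys_iff)
  hence "?d \<in> exps V" using assms exps_add_iff by metis
  moreover have "Poly_Mapping.single m 1 = X i * (Poly_Mapping.single ?d 1 :: 'k mpoly)"
    unfolding X_def mult_single using eq by simp
  ultimately show "X i divides\<^bsub>poly_ring V\<^esub> (Poly_Mapping.single m 1 :: 'k mpoly)"
    unfolding factor_def by (auto intro!: bexI[of _ "Poly_Mapping.single ?d 1"] simp: single_in_polys)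
qed

section \<open>Separations\<close>

text \<open>The exponent of the squarefree monomial \<open>x_N\<close>.\<close>

definition sq :: "nat set \<Rightarrow> (nat \<Rightarrow>\<^sub>0 nat)"
  where "sq N = (\<Sum>i\<in>N. Poly_Mapping.single i 1)"

lemma lookup_sum_single:
  "finite A \<Longrightarrow> Poly_Mapping.lookup (\<Sum>j\<in>A. Poly_Mapping.single j (g j)) l = (if l \<in> A then g l else 0)"
  by (auto simp: lookup_sum lookup_single when_def)

lemma lookup_sq: "finite N \<Longrightarrow> Poly_Mapping.lookup (sq N) j = (if j \<in> N then 1 else 0)"
  unfolding sq_def by (rule lookup_sum_single)

lemma keys_sq: "finite N \<Longrightarrow> Poly_Mapping.keys (sq N) = N"
  by (auto simp: in_keys_iff lookup_sq split: if_splits)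

lemma sq_le_iff: "finite N \<Longrightarrow> (\<exists>d. m = sq N + d) \<longleftrightarrow> N \<subseteq> Poly_Mapping.keys m"
proof
  assume "finite N" "N \<subseteq> Poly_Mapping.keys m"
  hence "m = sq N + (m - sq N)"
    by (intro poly_mapping_eqI) (auto simp: lookup_add lookup_minus lookup_sq in_keys_iff)
  thus "\<exists>d. m = sq N + d" ..
qed (auto simp: keys_add_nat keys_sq)

lemma prod_single:
  "(\<Prod>j\<in>A. Poly_Mapping.single (g j) 1) = (Poly_Mapping.single (\<Sum>j\<in>A. g j) 1 :: ('a::comm_monoid_add \<Rightarrow>\<^sub>0 'b::comm_semiring_1))"
  by (induction A rule: infinite_finite_induct) (auto simp: mult_single)

lemma prod_X: "(\<Prod>i\<in>N. X i) = (Poly_Mapping.single (sq N) 1 :: 'k::field mpoly)"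
  unfolding X_def prod_single sq_def ..

lemma X_power: "X j ^ k = (Poly_Mapping.single (Poly_Mapping.single j k) 1 :: 'k::field mpoly)"
  by (induction k) (auto simp: X_def mult_single single_add[symmetric])

definition SR_exps :: "nat \<Rightarrow> nat set set \<Rightarrow> (nat \<Rightarrow>\<^sub>0 nat) set"
  where "SR_exps n \<Delta> = {m \<in> exps {1..n}. Poly_Mapping.keys m \<notin> \<Delta>}"

lemma SR_exps_up_closed:
  assumes "simplicial_complex n \<Delta>"
  shows "up_closed {1..n} (SR_exps n \<Delta>)"
  unfolding up_closed_def SR_exps_def
proof (intro conjI ballI CollectI notI)
  fix a d assume a: "a \<in> {m \<in> exps {1..n}. Poly_Mapping.keys m \<notin> \<Delta>}" "d \<in> exps {1..n}"
  thus "a + d \<in> exps {1..n}" by (auto intro: exps_add)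
  assume "Poly_Mapping.keys (a + d) \<in> \<Delta>"
  hence "Poly_Mapping.keys a \<in> \<Delta>"
    using assms unfolding simplicial_complex_def keys_add_nat by blast
  thus False using a by simp
qed auto

text \<open>A monomial whose support is a nonface is a multiple of the squarefree monomial on its
  support, and supports only grow under multiplication.\<close>

lemma SR_ideal_eq:
  assumes "simplicial_complex n \<Delta>"
  shows "SR_ideal n \<Delta> = (polys (SR_exps n \<Delta>) :: 'k::field mpoly set)"
proof -
  let ?N = "sq ` {N. N \<subseteq> {1..n} \<and> N \<notin> \<Delta>}"
  have N: "?N \<subseteq> exps {1..n}" "?N \<subseteq> SR_exps n \<Delta>"
    by (simp_all add: image_subset_iff exps_def SR_exps_def keys_sq finite_subset[of _ "{1..n}"])
  have "{\<Prod>i\<in>N. X i | N. N \<subseteq> {1..n} \<and> N \<notin> \<Delta>} = (\<lambda>m. Poly_Mapping.single m (1 :: 'k)) ` ?N"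
    by (auto simp: prod_X)
  hence "SR_ideal n \<Delta> = (polys (upset {1..n} ?N) :: 'k mpoly set)"
    unfolding SR_ideal_def using Idl_monomials[OF N(1)] by simp
  moreover have "upset {1..n} ?N = SR_exps n \<Delta>"
  proof
    show "upset {1..n} ?N \<subseteq> SR_exps n \<Delta>"
      using SR_exps_up_closed[OF assms] N(2) unfolding upset_def up_closed_def by blast
    show "SR_exps n \<Delta> \<subseteq> upset {1..n} ?N"
    proof
      fix m assume m: "m \<in> SR_exps n \<Delta>"
      obtain d where d: "m = sq (Poly_Mapping.keys m) + d" using sq_le_iff[of "Poly_Mapping.keys m" m] by auto
      have "d \<in> exps {1..n}" using m exps_add_iff[of "sq (Poly_Mapping.keys m)" d] d by (simp add: SR_exps_def)
      moreover have "sq (Poly_Mapping.keys m) \<in> ?N" using m by (auto simp: SR_exps_def exps_def)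
      ultimately show "m \<in> upset {1..n} ?N" using d unfolding upset_def by blast
    qed
  qed
  ultimately show ?thesis by simp
qed

section \<open>The specialization of \<open>y\<close> to \<open>x_i\<close>\<close>

text \<open>The exponent of the image of a monomial when \<open>x_i\<close> is substituted for
  \<open>y\<close>.\<close>

definition merge :: "nat \<Rightarrow> (nat \<Rightarrow>\<^sub>0 nat) \<Rightarrow> (nat \<Rightarrow>\<^sub>0 nat)"
  where "merge i m = Poly_Mapping.update 0 0 m + Poly_Mapping.single i (Poly_Mapping.lookup m 0)"

lemma lookup_merge:
  "Poly_Mapping.lookup (merge i m) j =
    (if j = 0 then 0 else Poly_Mapping.lookup m j) + (if j = i then Poly_Mapping.lookup m 0 else 0)"
  by (auto simp: merge_def lookup_add lookup_update lookup_single when_def)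

lemma substitute_add: "substitute \<sigma> (f + g) = substitute \<sigma> f + substitute \<sigma> g"
  unfolding substitute_def
  by (rule setsum_keys_plus_distrib) (auto simp: Const_def single_add algebra_simps)

lemma substitute_single:
  "substitute (\<lambda>j. if j = 0 then X i else X j) (Poly_Mapping.single m c) =
    (Poly_Mapping.single (merge i m) c :: 'k::field mpoly)"
proof -
  let ?K = "Poly_Mapping.keys m" and ?e = "\<lambda>j. Poly_Mapping.single (if j = 0 then i else j) (Poly_Mapping.lookup m j)"
  have "(\<Prod>j\<in>?K. (if j = 0 then X i else X j) ^ Poly_Mapping.lookup m j) =
      (\<Prod>j\<in>?K. (Poly_Mapping.single (?e j) 1 :: 'k mpoly))"
    by (intro prod.cong) (auto simp: X_power)
  also have "\<dots> = Poly_Mapping.single (\<Sum>j\<in>?K. ?e j) 1" by (rule prod_single)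
  also have "(\<Sum>j\<in>?K. ?e j) = (\<Sum>j\<in>?K \<union> {0}. ?e j)"
    by (intro sum.mono_neutral_left) (auto simp: in_keys_iff)
  also have "\<dots> = ?e 0 + (\<Sum>j\<in>?K - {0}. ?e j)"
    by (subst sum.remove[of _ 0]) (auto intro!: sum.cong)
  also have "(\<Sum>j\<in>?K - {0}. ?e j) = (\<Sum>j\<in>?K - {0}. Poly_Mapping.single j (Poly_Mapping.lookup m j))"
    by (intro sum.cong) auto
  also have "\<dots> = Poly_Mapping.update 0 0 m"
    by (rule poly_mapping_eqI, subst lookup_sum_single) (auto simp: lookup_update in_keys_iff)
  finally have "(\<Prod>j\<in>?K. (if j = 0 then X i else X j) ^ Poly_Mapping.lookup m j) =
      (Poly_Mapping.single (merge i m) 1 :: 'k mpoly)"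
    by (simp add: merge_def add.commute)
  thus ?thesis
    by (auto simp: substitute_def Const_def mult_single)
qed

text \<open>The substitution is additive and maps terms to terms with the same coefficient, so it
  maps spans of monomials onto spans of monomials.\<close>

lemma substitute_polys:
  "substitute (\<lambda>j. if j = 0 then X i else X j) ` polys E = (polys (merge i ` E) :: 'k::field mpoly set)"
    (is "?s ` _ = _")
proof (intro equalityI subsetI)
  fix g :: "'k mpoly" assume "g \<in> ?s ` polys E"
  then obtain f where "f \<in> polys E" "g = ?s f" by blast
  moreover have "?s f \<in> polys (merge i ` E)" if "f \<in> polys E" for f :: "'k mpoly"
    using that
    by (induction f rule: poly_keys_induct)
       (auto simp: substitute_add substitute_single intro!: polys_add single_in_polys, simp add: substitute_def)
  ultimately show "g \<in> polys (merge i ` E)" by blast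
next
  fix g :: "'k mpoly" assume "g \<in> polys (merge i ` E)"
  thus "g \<in> ?s ` polys E"
  proof (induction g rule: poly_keys_induct)
    case zero
    show ?case by (rule image_eqI[of _ _ 0]) (auto simp: substitute_def)
  next
    case (add k c g)
    then obtain m f where "k = merge i m" "m \<in> E" "g = ?s f" "f \<in> polys E" by blast
    thus ?case
      by (intro image_eqI[of _ _ "Poly_Mapping.single m c + f"])
         (auto simp: substitute_add substitute_single intro!: polys_add single_in_polys)
  qed
qed

section \<open>Separations in terms of exponents\<close>

lemma (in ideal) coset_eq_ideal_iff:
  "b \<in> carrier R \<Longrightarrow> I +> b = I \<longleftrightarrow> b \<in> I"
  using a_rcos_self a_rcos_const by blast

text \<open>Replaces computations in the quotient by membership in \<open>I\<close>, where
  coefficients can be compared.\<close>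

lemma (in ideal) non_zero_divisor_Quot_iff:
  assumes "a \<in> carrier R"
  shows "non_zero_divisor (R Quot I) (I +> a) \<longleftrightarrow> (\<forall>b\<in>carrier R. a \<otimes> b \<in> I \<longrightarrow> b \<in> I)"
  using assms by (auto simp: non_zero_divisor_def FactRing_simps rcoset_mult_add coset_eq_ideal_iff)

lemma minus_X_exps: "s \<in> V \<Longrightarrow> t \<in> V \<Longrightarrow> X s - X t \<in> (polys (exps V) :: 'k::field mpoly set)"
  unfolding X_def by (intro polys_diff single_in_polys) (auto simp: exps_def)

text \<open>Apart from the non-zero divisor condition, which still ranges over all polynomials,
  everything becomes a condition on exponents.\<close>

lemma separation_iff:
  assumes \<Delta>: "simplicial_complex n \<Delta>" and i: "i \<in> {1..n}"
  shows "separation n (SR_ideal n \<Delta> :: 'k::field mpoly set) i J \<longleftrightarrow>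
    (\<exists>E. up_closed {0..n} E \<and> J = polys E \<and> merge i ` E = SR_exps n \<Delta> \<and>
      (\<exists>m\<in>min_exps E. i \<in> Poly_Mapping.keys m) \<and> (\<exists>m\<in>min_exps E. 0 \<in> Poly_Mapping.keys m) \<and>
      (\<forall>f\<in>polys (exps {0..n}). (X 0 - X i) * f \<in> J \<longrightarrow> f \<in> J))"
proof -
  have *: "(\<exists>u. minimal_monomial_generator {0..n} (polys E :: 'k mpoly set) u \<and> X j divides\<^bsub>poly_Sy n\<^esub> u) \<longleftrightarrow>
      (\<exists>m\<in>min_exps E. j \<in> Poly_Mapping.keys m)" if E: "up_closed {0..n} E" and j: "j \<in> {0..n}" for E j
  proof -
    have "min_exps E \<subseteq> exps {0..n}" using E by (auto simp: up_closed_def min_exps_def)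
    thus ?thesis
      unfolding minimal_monomial_generator_iff[OF E] using X_divides_single_iff[OF _ j, where ?'k = 'k] by blast
  qed
  have **: "non_zero_divisor (poly_Sy n Quot polys E) ((polys E :: 'k mpoly set) +>\<^bsub>poly_Sy n\<^esub> (X 0 - X i)) \<longleftrightarrow>
     (\<forall>f\<in>polys (exps {0..n}). (X 0 - X i) * f \<in> polys E \<longrightarrow> f \<in> (polys E :: 'k mpoly set))"
    if E: "up_closed {0..n} E" for E
  proof -
    interpret ideal "polys E :: 'k mpoly set" "poly_Sy n" by (rule polys_ideal[OF E])
    show ?thesis using i by (subst non_zero_divisor_Quot_iff) (auto intro: minus_X_exps)
  qed
  have 0: "0 \<in> {0..n}" and i: "i \<in> {0..n}" using i by auto
  have sep: "separation n (SR_ideal n \<Delta>) i (polys E :: 'k mpoly set) \<longleftrightarrow> merge i ` E = SR_exps n \<Delta> \<and>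
      (\<exists>m\<in>min_exps E. i \<in> Poly_Mapping.keys m) \<and> (\<exists>m\<in>min_exps E. 0 \<in> Poly_Mapping.keys m) \<and>
      (\<forall>f\<in>polys (exps {0..n}). (X 0 - X i) * f \<in> polys E \<longrightarrow> f \<in> (polys E :: 'k mpoly set))"
    if E: "up_closed {0..n} E" for E
    unfolding separation_def monomial_ideal_iff SR_ideal_eq[OF \<Delta>] substitute_polys polys_eq_iff
      *[OF E 0] *[OF E i] **[OF E] using E by blast
  show ?thesis
  proof
    assume *: "separation n (SR_ideal n \<Delta> :: 'k mpoly set) i J"
    then obtain E where E: "up_closed {0..n} E" "J = polys E"
      by (auto simp: separation_def monomial_ideal_iff)
    thus "\<exists>E. up_closed {0..n} E \<and> J = polys E \<and> merge i ` E = SR_exps n \<Delta> \<and>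
      (\<exists>m\<in>min_exps E. i \<in> Poly_Mapping.keys m) \<and> (\<exists>m\<in>min_exps E. 0 \<in> Poly_Mapping.keys m) \<and>
      (\<forall>f\<in>polys (exps {0..n}). (X 0 - X i) * f \<in> J \<longrightarrow> f \<in> J)"
      using * sep[OF E(1)] by blast
  qed (use sep in blast)
qed

lemma single_add_sub:
  assumes "i \<in> Poly_Mapping.keys (m :: 'a \<Rightarrow>\<^sub>0 nat)"
  obtains m' where "m = m' + Poly_Mapping.single i 1"
proof
  show "m = (m - Poly_Mapping.single i 1) + Poly_Mapping.single i 1"
    using assms by (intro poly_mapping_eqI) (auto simp: lookup_add lookup_minus lookup_single when_def in_keys_iff)
qed

section \<open>The graph and the minimal generators of a separation\<close>

lemma G_vertices_props:
  assumes "simplicial_complex n \<Delta>" "F \<in> G_vertices i \<Delta>"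
  shows "F \<subseteq> {1..n}" "finite F" "i \<notin> F" "0 \<notin> F"
proof -
  show F: "F \<subseteq> {1..n}" using assms unfolding simplicial_complex_def G_vertices_def by blast
  thus "finite F" by (rule finite_subset) simp
  show "0 \<notin> F" using F by auto
  show "i \<notin> F" using assms(2) by (simp add: G_vertices_def)
qed

text \<open>\<open>F \<union> {i}\<close> is contained in \<open>G \<union> {i}\<close>, so the
  latter is no face; in particular \<open>i\<close> is not in \<open>G\<close>. Hence each face
  properly containing a vertex is a neighbour of it.\<close>

lemma G_vertices_mono:
  assumes "simplicial_complex n \<Delta>" "F \<in> G_vertices i \<Delta>" "F \<subseteq> G" "G \<in> \<Delta>" 
  shows "G \<in> G_vertices i \<Delta>"
proof -
  have down: "\<And>A B. A \<in> \<Delta> \<Longrightarrow> B \<subseteq> A \<Longrightarrow> B \<in> \<Delta>" using assms(1) unfolding simplicial_complex_def by blast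
  have "G \<union> {i} \<notin> \<Delta>" using assms down[of "G \<union> {i}" "F \<union> {i}"] by (auto simp: G_vertices_def)
  moreover have "i \<notin> G" using calculation assms(4) by (auto simp: insert_absorb)
  ultimately show ?thesis using assms by (auto simp: G_vertices_def)
qed

lemma graph_connected_G_graph_invariant:
  assumes "graph_connected (G_graph i \<Delta>)" "u \<in> G_vertices i \<Delta>" "v \<in> G_vertices i \<Delta>"
    and step: "\<And>F G. F \<in> G_vertices i \<Delta> \<Longrightarrow> G \<in> G_vertices i \<Delta> \<Longrightarrow> F \<subset> G \<Longrightarrow> f F = f G"
  shows "f u = f v"
proof -
  have "(u, v) \<in> {(a, b). {a, b} \<in> snd (G_graph i \<Delta>)}\<^sup>*"
    using assms by (auto simp: graph_connected_def G_graph_def)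
  thus ?thesis
  proof (induction rule: rtrancl_induct)
    case (step y z)
    then obtain F G where "{y, z} = {F, G}" "F \<in> G_vertices i \<Delta>" "G \<in> G_vertices i \<Delta>" "F \<subset> G \<or> G \<subset> F"
      by (auto simp: G_graph_def)
    hence "f y = f z" using assms(4) by (metis doubleton_eq_iff)
    thus ?case using step by simp
  qed simp
qed

text \<open>\<open>A\<close> is the connected component of \<open>u\<close>.\<close>

lemma G_graph_disconnected_cut:
  assumes "\<not> graph_connected (G_graph i \<Delta>)"
  obtains A u v where "A \<subseteq> G_vertices i \<Delta>" "u \<in> A" "v \<in> G_vertices i \<Delta>" "v \<notin> A"
    "\<And>F G. F \<in> G_vertices i \<Delta> \<Longrightarrow> G \<in> G_vertices i \<Delta> \<Longrightarrow> F \<subseteq> G \<Longrightarrow> F \<in> A \<longleftrightarrow> G \<in> A"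
proof -
  let ?R = "{(a, b). {a, b} \<in> snd (G_graph i \<Delta>)}"
  obtain u v where uv: "u \<in> G_vertices i \<Delta>" "v \<in> G_vertices i \<Delta>" "(u, v) \<notin> ?R\<^sup>*"
    using assms by (auto simp: graph_connected_def G_graph_def)
  show thesis
  proof (rule that[of "{F \<in> G_vertices i \<Delta>. (u, F) \<in> ?R\<^sup>*}" u v])
    fix F G assume FG: "F \<in> G_vertices i \<Delta>" "G \<in> G_vertices i \<Delta>" "F \<subseteq> G"
    show "F \<in> {F \<in> G_vertices i \<Delta>. (u, F) \<in> ?R\<^sup>*} \<longleftrightarrow> G \<in> {F \<in> G_vertices i \<Delta>. (u, F) \<in> ?R\<^sup>*}"
    proof (cases "F = G")
      case False
      hence "(F, G) \<in> ?R" "(G, F) \<in> ?R" using FG by (auto simp: G_graph_def)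
      thus ?thesis using FG by (auto intro: rtrancl_into_rtrancl)
    qed simp
  qed (use uv in auto)
qed

text \<open>The hypothesis \<open>nzd\<close> is all that is used of \<open>X s - X t\<close> being a non-zero divisor.
  The set \<open>{s, t}\<close> is \<open>{0, i}\<close>, which serves both variables of a separation at once.\<close>

lemma separation_variable_unused:
  assumes \<Delta>: "simplicial_complex n \<Delta>" and i: "i \<in> {1..n}" and st: "{s, t} = {0, i}"
    and E: "up_closed {0..n} E" "merge i ` E = SR_exps n \<Delta>"
    and nzd: "\<And>m. m + Poly_Mapping.single s 1 \<in> E \<Longrightarrow> m + Poly_Mapping.single t 1 \<in> E \<Longrightarrow> m \<in> E"
    and all: "\<And>F. F \<in> G_vertices i \<Delta> \<Longrightarrow> sq F + Poly_Mapping.single s 1 \<in> E"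
    and m: "m \<in> min_exps E"
  shows "t \<notin> Poly_Mapping.keys m"
proof
  assume t: "t \<in> Poly_Mapping.keys m"
  \<comment> \<open>\<open>G\<close> is the support of \<open>m\<close> away from \<open>x_i\<close>
    and \<open>y\<close>; \<open>c\<close> arises from \<open>m\<close> by deleting these two
    variables.\<close>
  define G where "G = Poly_Mapping.keys m - {0, i}"
  define c where "c = Poly_Mapping.update 0 0 (Poly_Mapping.update i 0 m)"
  have lc: "Poly_Mapping.lookup c j = (if j = 0 \<or> j = i then 0 else Poly_Mapping.lookup m j)" for j
    by (simp add: c_def lookup_update)
  have kc: "Poly_Mapping.keys c = G" by (auto simp: in_keys_iff lc G_def split: if_splits)
  have mE: "m \<in> E" using m by (simp add: min_exps_def)
  hence mV: "m \<in> exps {0..n}" using E(1) by (auto simp: up_closed_def)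
  have "{0..n} - {0, i} \<subseteq> {1..n}" by auto
  hence GV: "G \<subseteq> {1..n}" using mV unfolding exps_def G_def by blast
  have min: "d = 0" if "a \<in> E" "m = a + d" for a d using m that by (auto simp: min_exps_def)
  \<comment> \<open>As \<open>t\<close> occurs in \<open>m\<close>, specializing gives the support
    \<open>insert i G\<close>, which must be a nonface.\<close>
  have "Poly_Mapping.keys (merge i m) = insert i G"
    using t st i by (auto simp: in_keys_iff lookup_merge G_def doubleton_eq_iff split: if_splits)
  moreover have "merge i m \<in> SR_exps n \<Delta>" using E(2) mE by blast
  ultimately have iG: "insert i G \<notin> \<Delta>" by (simp add: SR_exps_def)
  show False
  proof (cases "G \<in> \<Delta>")
    case False
    \<comment> \<open>Some \<open>a\<close> in \<open>E\<close> specializes to \<open>c\<close>. As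
      \<open>x_i\<close> does not occur in \<open>c\<close>, neither \<open>x_i\<close> nor
      \<open>y\<close> occurs in \<open>a\<close>, so \<open>a = c\<close>. Minimality gives
      \<open>m = c\<close>, although \<open>t\<close> does not occur in \<open>c\<close>.\<close>
    hence "c \<in> merge i ` E" unfolding E(2) using GV by (simp add: SR_exps_def exps_def kc)
    then obtain a where a: "a \<in> E" "merge i a = c" by blast
    have "a = c"
    proof (rule poly_mapping_eqI)
      fix j
      have "Poly_Mapping.lookup a 0 = 0" "Poly_Mapping.lookup a i = 0"
        using arg_cong[OF a(2), of "\<lambda>c. Poly_Mapping.lookup c i"] i by (auto simp: lookup_merge lc)
      thus "Poly_Mapping.lookup a j = Poly_Mapping.lookup c j"
        using arg_cong[OF a(2), of "\<lambda>c. Poly_Mapping.lookup c j"] by (auto simp: lookup_merge lc split: if_splits)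
    qed
    moreover have "m = c + (m - c)"
      by (intro poly_mapping_eqI) (auto simp: lookup_add lookup_minus lc)
    ultimately have "m = c" using min[of c "m - c"] a by auto
    hence "t \<in> G" using t kc by metis
    thus False using st by (auto simp: G_def doubleton_eq_iff)
  next
    case True
    hence G: "G \<in> G_vertices i \<Delta>" using iG by (auto simp: G_vertices_def G_def)
    obtain m' where m': "m = m' + Poly_Mapping.single t 1" using t by (rule single_add_sub)
    have "t \<notin> G" using st by (auto simp: G_def doubleton_eq_iff)
    hence "G \<subseteq> Poly_Mapping.keys m'" using m' by (auto simp: G_def keys_add_nat split: if_splits)
    then obtain d where d: "m' = sq G + d" using sq_le_iff[of G m'] by (auto simp: G_def)
    have "d \<in> exps {0..n}" using mV unfolding m' d by (simp add: exps_add_iff)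
    \<comment> \<open>Replacing one factor \<open>x_t\<close> of \<open>m\<close> by
      \<open>x_s\<close> gives a multiple of \<open>x_s * x_G\<close>, again in the ideal. So
      \<open>nzd\<close> puts the proper divisor \<open>m'\<close> of \<open>m\<close> into
      \<open>E\<close>.\<close>
    hence "sq G + Poly_Mapping.single s 1 + d \<in> E" using all[OF G] E(1) by (auto simp: up_closed_def)
    moreover have "sq G + Poly_Mapping.single s 1 + d = m' + Poly_Mapping.single s 1"
      unfolding d by (simp add: algebra_simps)
    ultimately have "m' \<in> E" using mE nzd[of m'] unfolding m' by simp
    thus False using min[OF _ m'] by (metis lookup_single_eq lookup_zero zero_neq_one)
  qed
qed

section \<open>Connectedness excludes separations\<close>

lemma connected_imp_not_separation:
  assumes \<Delta>: "simplicial_complex n \<Delta>" and i: "i \<in> {1..n}"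
    and conn: "graph_connected (G_graph i \<Delta>)"
  shows "\<not> separation n (SR_ideal n \<Delta> :: 'k::field mpoly set) i J"
proof
  assume "separation n (SR_ideal n \<Delta> :: 'k mpoly set) i J"
  then obtain E where E: "up_closed {0..n} E" "merge i ` E = SR_exps n \<Delta>"
    and min: "\<exists>m\<in>min_exps E. i \<in> Poly_Mapping.keys m" "\<exists>m\<in>min_exps E. 0 \<in> Poly_Mapping.keys m"
    and nzd: "\<And>f. f \<in> polys (exps {0..n}) \<Longrightarrow> (X 0 - X i) * f \<in> polys E \<Longrightarrow> f \<in> (polys E :: 'k mpoly set)"
    unfolding separation_iff[OF \<Delta> i] by blast
  \<comment> \<open>The product of a monomial with \<open>y - x_i\<close> is a difference of two
    monomials, so the criterion applies to exponents.\<close>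
  have nzd': "m \<in> E" if "m + Poly_Mapping.single 0 1 \<in> E" "m + Poly_Mapping.single i 1 \<in> E" for m
  proof -
    have "m + Poly_Mapping.single i 1 \<in> exps {0..n}" using E(1) that(2) by (auto simp: up_closed_def)
    hence "m \<in> exps {0..n}" by (simp add: exps_add_iff)
    moreover have "(X 0 - X i) * Poly_Mapping.single m 1 =
       (Poly_Mapping.single (m + Poly_Mapping.single 0 1) 1 - Poly_Mapping.single (m + Poly_Mapping.single i 1) 1 :: 'k mpoly)"
      by (simp add: X_def algebra_simps mult_single)
    hence "(X 0 - X i) * Poly_Mapping.single m 1 \<in> (polys E :: 'k mpoly set)"
      using that by (auto intro: polys_diff single_in_polys)
    ultimately have "Poly_Mapping.single m 1 \<in> (polys E :: 'k mpoly set)" using nzd[OF single_in_polys] by blast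
    thus ?thesis by (simp add: single_in_polys_iff)
  qed
  have fin: "finite F" and notin: "i \<notin> F" "F \<subseteq> {1..n}" "0 \<notin> F" if "F \<in> G_vertices i \<Delta>" for F
    using G_vertices_props[OF \<Delta> that] by blast+
  let ?P = "\<lambda>s F. sq F + Poly_Mapping.single s 1 \<in> E"
  \<comment> \<open>\<open>x_i * x_F\<close> lies in the ideal of the complex, so it has a preimage
    in \<open>J\<close>. The exponents of \<open>x_i\<close> and \<open>y\<close> in that preimage
    add up to 1, which leaves two possibilities.\<close>
  have some: "?P i F \<or> ?P 0 F" if F: "F \<in> G_vertices i \<Delta>" for F
  proof -
    have "sq F + Poly_Mapping.single i 1 \<in> merge i ` E"
      unfolding E(2) using F fin[OF F] notin[OF F] i by (auto simp: SR_exps_def exps_def keys_add_nat keys_sq G_vertices_def)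
    then obtain a where a': "sq F + Poly_Mapping.single i 1 = merge i a" and a: "a \<in> E" by (rule imageE)
    have l: "Poly_Mapping.lookup (merge i a) j = (if j \<in> F then 1 else 0) + (1 when i = j)" for j
      unfolding a'[symmetric] by (simp add: lookup_add lookup_sq fin[OF F] lookup_single)
    have "Poly_Mapping.lookup a 0 + Poly_Mapping.lookup a i = 1"
      using l[of i] notin[OF F] i by (auto simp: lookup_merge)
    hence "(Poly_Mapping.lookup a 0 = 0 \<and> Poly_Mapping.lookup a i = 1) \<or> (Poly_Mapping.lookup a 0 = 1 \<and> Poly_Mapping.lookup a i = 0)"
      by linarith
    hence "a = sq F + Poly_Mapping.single i 1 \<or> a = sq F + Poly_Mapping.single 0 1"
    proof (elim disjE)
      assume *: "Poly_Mapping.lookup a 0 = 0 \<and> Poly_Mapping.lookup a i = 1"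
      have "Poly_Mapping.lookup a j = Poly_Mapping.lookup (sq F + Poly_Mapping.single i 1) j" for j
        using l[of j] * notin[OF F] i
        by (auto simp: lookup_merge lookup_add lookup_sq fin[OF F] lookup_single when_def split: if_splits)
      thus ?thesis by (auto intro: poly_mapping_eqI)
    next
      assume *: "Poly_Mapping.lookup a 0 = 1 \<and> Poly_Mapping.lookup a i = 0"
      have "Poly_Mapping.lookup a j = Poly_Mapping.lookup (sq F + Poly_Mapping.single 0 1) j" for j
        using l[of j] * notin[OF F] i
        by (auto simp: lookup_merge lookup_add lookup_sq fin[OF F] lookup_single when_def split: if_splits)
      thus ?thesis by (auto intro: poly_mapping_eqI)
    qed
    thus ?thesis using a by blast
  qed
  \<comment> \<open>Otherwise \<open>x_F\<close> lies in \<open>J\<close> and specializes to itself,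
    although \<open>F\<close> is a face.\<close>
  have not_both: "\<not> (?P i F \<and> ?P 0 F)" if F: "F \<in> G_vertices i \<Delta>" for F
  proof
    assume "?P i F \<and> ?P 0 F"
    hence "sq F \<in> E" using nzd' by blast
    hence "merge i (sq F) \<in> SR_exps n \<Delta>" using E(2) by blast
    moreover have "merge i (sq F) = sq F"
      using notin[OF F] by (intro poly_mapping_eqI) (auto simp: lookup_merge lookup_sq fin[OF F])
    ultimately show False using F by (simp add: SR_exps_def keys_sq fin[OF F] G_vertices_def)
  qed
  have up: "?P s G" if P: "?P s F" and F: "F \<in> G_vertices i \<Delta>" and G: "G \<in> G_vertices i \<Delta>" and FG: "F \<subset> G" for s F G
  proof -
    obtain d where d: "sq G = sq F + d"
      using sq_le_iff[OF fin[OF F], of "sq G"] FG by (auto simp: keys_sq fin[OF G])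
    have "sq G \<in> exps {0..n}" using notin(2)[OF G] by (auto simp: exps_def keys_sq fin[OF G])
    hence "d \<in> exps {0..n}" by (simp add: d exps_add_iff)
    hence "sq F + Poly_Mapping.single s 1 + d \<in> E" using P E(1) by (auto simp: up_closed_def)
    thus ?thesis by (simp add: d algebra_simps)
  qed
  \<comment> \<open>Both alternatives pass from \<open>F\<close> to a larger \<open>G\<close>. As
    exactly one holds at each vertex, neither can change along an edge.\<close>
  have const: "?P i F = ?P i G" if "F \<in> G_vertices i \<Delta>" "G \<in> G_vertices i \<Delta>" for F G
  proof (rule graph_connected_G_graph_invariant[OF conn that])
    fix F G assume "F \<in> G_vertices i \<Delta>" "G \<in> G_vertices i \<Delta>" "F \<subset> G"
    thus "?P i F = ?P i G" using up some not_both by blast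
  qed
  show False
  \<comment> \<open>If \<open>x_i * x_F\<close> is chosen everywhere, \<open>y\<close> occurs in no
    minimal generator; otherwise \<open>y * x_F\<close> is chosen everywhere and \<open>x_i\<close>
    occurs in none.\<close>
  proof (cases "\<forall>F\<in>G_vertices i \<Delta>. ?P i F")
    case True
    thus False using min(2) separation_variable_unused[OF \<Delta> i _ E, of i 0] nzd' by blast
  next
    case False
    hence "\<forall>F\<in>G_vertices i \<Delta>. ?P 0 F" using const some by blast
    thus False using min(1) separation_variable_unused[OF \<Delta> i _ E, of 0 i] nzd' by blast
  qed
qed

section \<open>A cut of the graph yields a separation\<close>

lemma lookup_X_times_add: "Poly_Mapping.lookup (X s * f) (m + Poly_Mapping.single s 1) = Poly_Mapping.lookup f m"
  using lookup_single_times_add[of "Poly_Mapping.single s 1" 1 f m] by (simp add: X_def add.commute)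

lemma lookup_X_times_0: "s \<notin> Poly_Mapping.keys m \<Longrightarrow> Poly_Mapping.lookup (X s * f) m = 0"
  unfolding X_def by (rule lookup_single_times_0) (auto simp: keys_add_nat)

text \<open>Comparing coefficients in \<open>X s * f - X t * f\<close> moves a coefficient of \<open>f\<close> outside of \<open>E\<close>
  from the exponent \<open>m + \<epsilon>\<^sub>t\<close> to \<open>m + \<epsilon>\<^sub>s\<close>; this ends when the exponent of \<open>x\<^sub>t\<close> is zero.\<close>

lemma lookup_eq_zero_of_diff_mult:
  fixes f :: "'k::field mpoly"
  assumes h: "(X s - X t) * f \<in> polys E" and "s \<noteq> t"
    and M1: "\<And>m. m \<in> M \<Longrightarrow> m + Poly_Mapping.single s 1 \<notin> E"
    and M2: "\<And>m. m + Poly_Mapping.single t 1 \<in> M \<Longrightarrow> m + Poly_Mapping.single s 1 \<in> M"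
    and "m \<in> M"
  shows "Poly_Mapping.lookup f m = 0"
  using \<open>m \<in> M\<close>
proof (induction "Poly_Mapping.lookup m t" arbitrary: m)
  \<comment> \<open>The exponent \<open>m + Poly_Mapping.single s 1\<close> is outside
    \<open>E\<close>, so \<open>X s * f\<close> and \<open>X t * f\<close> have the same coefficient
    there.\<close>
  have eq: "Poly_Mapping.lookup f m = Poly_Mapping.lookup (X t * f) (m + Poly_Mapping.single s 1)" if "m \<in> M" for m
  proof -
    have "Poly_Mapping.lookup ((X s - X t) * f) (m + Poly_Mapping.single s 1) = 0"
      using h M1[OF that] by (auto simp: polys_def in_keys_iff)
    moreover have "(X s - X t) * f = X s * f - X t * f" by (simp add: algebra_simps)
    ultimately show ?thesis by (simp add: lookup_minus lookup_X_times_add del: One_nat_def)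
  qed
  {
    case 0
    hence "t \<notin> Poly_Mapping.keys (m + Poly_Mapping.single s 1)"
      using \<open>s \<noteq> t\<close> by (auto simp: keys_add_nat in_keys_iff lookup_single when_def)
    thus ?case using eq[OF 0(2)] lookup_X_times_0 by metis
  next
    case (Suc x)
    then obtain m' where m': "m = m' + Poly_Mapping.single t 1"
      by (metis single_add_sub in_keys_iff nat.distinct(1))
    hence "m + Poly_Mapping.single s 1 = (m' + Poly_Mapping.single s 1) + Poly_Mapping.single t 1"
      by (simp add: algebra_simps)
    hence "Poly_Mapping.lookup f m = Poly_Mapping.lookup f (m' + Poly_Mapping.single s 1)"
      using eq[OF Suc(3)] lookup_X_times_add by metis
    also have "\<dots> = 0"
      using Suc(2) \<open>s \<noteq> t\<close> M2[of m'] Suc(3)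
      by (intro Suc(1)) (auto simp: m' lookup_add lookup_single when_def)
    finally show ?case .
  }
qed

lemma disconnected_imp_separation:
  assumes \<Delta>: "simplicial_complex n \<Delta>" and i: "i \<in> {1..n}"
    and disconn: "\<not> graph_connected (G_graph i \<Delta>)"
  shows "\<exists>J. separation n (SR_ideal n \<Delta> :: 'k::field mpoly set) i J"
proof -
  have down: "\<And>A B. A \<in> \<Delta> \<Longrightarrow> B \<subseteq> A \<Longrightarrow> B \<in> \<Delta>" using \<Delta> unfolding simplicial_complex_def by blast
  obtain A u v where A: "A \<subseteq> G_vertices i \<Delta>" and uv: "u \<in> A" "v \<in> G_vertices i \<Delta>" "v \<notin> A"
    and edge: "\<And>F G. F \<in> G_vertices i \<Delta> \<Longrightarrow> G \<in> G_vertices i \<Delta> \<Longrightarrow> F \<subseteq> G \<Longrightarrow> F \<in> A \<longleftrightarrow> G \<in> A"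
    using G_graph_disconnected_cut[OF disconn] by metis
  define B where "B = G_vertices i \<Delta> - A"
  have V\<Delta>: "G_vertices i \<Delta> \<subseteq> \<Delta>" by (auto simp: G_vertices_def)
  let ?G = "\<lambda>m :: nat \<Rightarrow>\<^sub>0 nat. Poly_Mapping.keys m - {0, i}"
  \<comment> \<open>The exponents of the ideal generated by \<open>x_i * x_F\<close> for
    \<open>F\<close> in \<open>A\<close>, \<open>y * x_F\<close> for \<open>F\<close> in
    \<open>B\<close>, and \<open>x_N\<close> for the nonfaces \<open>N\<close> without
    \<open>i\<close>.\<close>
  define E where "E = {m \<in> exps {0..n}. ?G m \<notin> \<Delta> \<or> (i \<in> Poly_Mapping.keys m \<and> ?G m \<in> A) \<or>
    (0 \<in> Poly_Mapping.keys m \<and> ?G m \<in> B)}"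
  have up: "up_closed {0..n} E"
    unfolding up_closed_def
  proof (intro conjI ballI)
    fix a d assume a: "a \<in> E" and d: "d \<in> exps {0..n}"
    have sub: "?G a \<subseteq> ?G (a + d)" by (auto simp: keys_add_nat)
    \<comment> \<open>A face containing \<open>?G a\<close> is a vertex on the same side of the cut;
      if \<open>?G (a + d)\<close> is no face, \<open>a + d\<close> is in \<open>E\<close>
      anyway.\<close>
    have up: "?G (a + d) \<in> A" if "?G a \<in> A" "?G (a + d) \<in> \<Delta>"
      using that sub A edge G_vertices_mono[OF \<Delta>] by blast
    have up': "?G (a + d) \<in> B" if "?G a \<in> B" "?G (a + d) \<in> \<Delta>"
      using that sub A edge G_vertices_mono[OF \<Delta>] unfolding B_def by blast
    have "i \<in> Poly_Mapping.keys a \<Longrightarrow> i \<in> Poly_Mapping.keys (a + d)"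
      "0 \<in> Poly_Mapping.keys a \<Longrightarrow> 0 \<in> Poly_Mapping.keys (a + d)"
      by (auto simp: keys_add_nat)
    moreover have "?G a \<notin> \<Delta> \<Longrightarrow> ?G (a + d) \<notin> \<Delta>" using down sub by blast
    moreover have "a + d \<in> exps {0..n}" using a d by (simp add: E_def exps_add)
    ultimately show "a + d \<in> E" using a up up' unfolding E_def by blast
  qed (auto simp: E_def)
  have i0: "i \<noteq> 0" using i by auto
  have km: "Poly_Mapping.keys (merge i m) =
      ?G m \<union> (if i \<in> Poly_Mapping.keys m \<or> 0 \<in> Poly_Mapping.keys m then {i} else {})" for m
  proof (rule Set.set_eqI)
    fix x show "x \<in> Poly_Mapping.keys (merge i m) \<longleftrightarrow>
      x \<in> ?G m \<union> (if i \<in> Poly_Mapping.keys m \<or> 0 \<in> Poly_Mapping.keys m then {i} else {})"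
      using i0 by (cases "x = 0"; cases "x = i") (auto simp: in_keys_iff lookup_merge)
  qed
  have "merge i ` E = SR_exps n \<Delta>"
  proof (intro equalityI subsetI)
    fix k assume "k \<in> merge i ` E"
    then obtain m where m: "m \<in> E" "k = merge i m" by blast
    have "{0..n} - {0, i} \<subseteq> {1..n}" by auto
    hence "Poly_Mapping.keys k \<subseteq> {1..n}"
      using m(1) i subset_trans[of "?G m" "{0..n} - {0, i}" "{1..n}"] unfolding m(2) km E_def exps_def by auto
    moreover have "Poly_Mapping.keys k \<notin> \<Delta>"
    proof
      assume k: "Poly_Mapping.keys k \<in> \<Delta>"
      hence "?G m \<in> \<Delta>" using down unfolding m(2) km by blast
      hence "(i \<in> Poly_Mapping.keys m \<or> 0 \<in> Poly_Mapping.keys m) \<and> ?G m \<in> G_vertices i \<Delta>"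
        using m(1) A unfolding E_def B_def by blast
      thus False using k unfolding m(2) km by (auto simp: G_vertices_def)
    qed
    ultimately show "k \<in> SR_exps n \<Delta>" by (simp add: SR_exps_def exps_def)
  next
    fix k assume k: "k \<in> SR_exps n \<Delta>"
    have k0: "0 \<notin> Poly_Mapping.keys k" using k by (auto simp: SR_exps_def exps_def)
    have kE: "k \<in> exps {0..n}" using k by (auto simp: SR_exps_def exps_def)
    have k\<Delta>: "Poly_Mapping.keys k \<notin> \<Delta>" using k by (simp add: SR_exps_def)
    have Gk: "?G k = Poly_Mapping.keys k - {i}" using k0 by auto
    show "k \<in> merge i ` E"
    proof (cases "?G k \<in> B")
      case False
      \<comment> \<open>Away from \<open>B\<close> the exponent \<open>k\<close> is its own
        preimage.\<close>
      have "?G k \<notin> \<Delta> \<or> (i \<in> Poly_Mapping.keys k \<and> ?G k \<in> A)"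
      proof (cases "?G k \<in> \<Delta>")
        case True
        hence "?G k \<noteq> Poly_Mapping.keys k" using k\<Delta> by metis
        hence "i \<in> Poly_Mapping.keys k" using Gk by blast
        moreover from this have "?G k \<in> G_vertices i \<Delta>"
          using True k\<Delta> unfolding Gk by (simp add: G_vertices_def insert_absorb)
        ultimately show ?thesis using False by (auto simp: B_def)
      qed simp
      hence "k \<in> E" using kE by (auto simp: E_def)
      moreover have "merge i k = k"
        using k0 by (intro poly_mapping_eqI) (auto simp: lookup_merge in_keys_iff)
      ultimately show ?thesis by (metis image_eqI)
    next
      case True
      \<comment> \<open>The whole power of \<open>x_i\<close> in \<open>k\<close> is moved to
        \<open>y\<close>, since \<open>k\<close> need not be squarefree.\<close>
      define m where "m = Poly_Mapping.update i 0 k + Poly_Mapping.single 0 (Poly_Mapping.lookup k i)"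
      have lm: "Poly_Mapping.lookup m j = (if j = i then 0 else Poly_Mapping.lookup k j) +
          (if j = 0 then Poly_Mapping.lookup k i else 0)" for j
        by (simp add: m_def lookup_add lookup_update lookup_single when_def)
      have "?G k \<in> \<Delta>" using True V\<Delta> unfolding B_def by blast
      hence "?G k \<noteq> Poly_Mapping.keys k" using k\<Delta> by metis
      hence ik: "i \<in> Poly_Mapping.keys k" using Gk by blast
      have km': "Poly_Mapping.keys m = insert 0 (Poly_Mapping.keys k - {i})"
        using ik i0 k0 by (auto simp: in_keys_iff lm split: if_splits)
      have "?G m = ?G k" unfolding km' Gk using k0 by blast
      moreover have "Poly_Mapping.keys m \<subseteq> {0..n}"
        using kE unfolding exps_def km' by (simp add: subset_iff)
      hence "m \<in> exps {0..n}" by (simp add: exps_def)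
      moreover have "0 \<in> Poly_Mapping.keys m" unfolding km' by simp
      ultimately have "m \<in> E" unfolding E_def using True by simp
      moreover have "merge i m = k"
        using k0 i0 by (intro poly_mapping_eqI) (auto simp: lookup_merge in_keys_iff lm)
      ultimately show ?thesis by (metis image_eqI)
    qed
  qed
  \<comment> \<open>A minimal exponent dividing \<open>x_s * x_F\<close> must involve
    \<open>s\<close>: otherwise its support is a face containing neither \<open>0\<close> nor
    \<open>i\<close>, and such exponents are not in \<open>E\<close>.\<close>
  moreover have "\<exists>m\<in>min_exps E. s \<in> Poly_Mapping.keys m"
    if s: "s = i \<or> s = 0" and F: "F \<in> G_vertices i \<Delta>" and FE: "sq F + Poly_Mapping.single s 1 \<in> E" for s F
  proof -
    have F': "F \<subseteq> {1..n}" "i \<notin> F" "0 \<notin> F" 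
      and fin: "finite F" using G_vertices_props[OF \<Delta> F] by blast+
    obtain a d where a: "a \<in> min_exps E" "sq F + Poly_Mapping.single s 1 = a + d"
      using min_exps_below[OF FE] by blast
    have "Poly_Mapping.keys (sq F + Poly_Mapping.single s 1) = Poly_Mapping.keys a \<union> Poly_Mapping.keys d"
      unfolding a(2) by (rule keys_add_nat)
    hence ka: "Poly_Mapping.keys a \<subseteq> insert s F" by (simp add: keys_add_nat keys_sq fin)
    have "s \<in> Poly_Mapping.keys a"
    proof (rule ccontr)
      assume "s \<notin> Poly_Mapping.keys a"
      hence "Poly_Mapping.keys a \<subseteq> F" using ka by auto
      moreover from this have "?G a \<in> \<Delta>" using F V\<Delta> down[of F "?G a"] by blast
      ultimately show False using a(1) F' by (auto simp: min_exps_def E_def)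
    qed
    thus ?thesis using a(1) by blast
  qed
  note min = this
  have V: "F \<subseteq> {1..n}" "finite F" "i \<notin> F" "0 \<notin> F" if "F \<in> G_vertices i \<Delta>" for F
    using G_vertices_props[OF \<Delta> that] by blast+
  have "sq F + Poly_Mapping.single s 1 \<in> E"
    if "F \<in> G_vertices i \<Delta>" "(s = i \<and> F \<in> A) \<or> (s = 0 \<and> F \<in> B)" for F s
  proof -
    have k: "Poly_Mapping.keys (sq F + Poly_Mapping.single s 1) = insert s F"
      using V[OF that(1)] by (simp add: keys_add_nat keys_sq)
    hence "?G (sq F + Poly_Mapping.single s 1) = F" using V[OF that(1)] that(2) by auto
    moreover have "sq F + Poly_Mapping.single s 1 \<in> exps {0..n}"
      using k V[OF that(1)] that(2) i by (force simp: exps_def)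
    ultimately show ?thesis using that(2) k unfolding E_def by auto
  qed
  hence "\<exists>m\<in>min_exps E. i \<in> Poly_Mapping.keys m" "\<exists>m\<in>min_exps E. 0 \<in> Poly_Mapping.keys m"
    using min[of i u] min[of 0 v] uv A by (auto simp: B_def)
  \<comment> \<open>Exponents outside \<open>E\<close> are split by whether \<open>?G m\<close> is
    in \<open>B\<close>. If it is not, multiplication by \<open>y\<close> does not lead into
    \<open>E\<close>; if it is, multiplication by \<open>x_i\<close> does not. The two cases take
    \<open>s = 0\<close> and \<open>s = i\<close> in
    \<open>lookup_eq_zero_of_diff_mult\<close>.\<close>
  moreover have "f \<in> polys E" if f: "f \<in> polys (exps {0..n})" "(X 0 - X i) * f \<in> polys E" for f :: "'k mpoly"
  proof -
    have G_add: "?G (m + Poly_Mapping.single s 1) = ?G m" if "s = 0 \<or> s = i" for m s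
      unfolding keys_add_nat using that by auto
    have k_add: "Poly_Mapping.keys (m + Poly_Mapping.single s 1) = insert s (Poly_Mapping.keys m)"
      for m :: "nat \<Rightarrow>\<^sub>0 nat" and s
      by (auto simp: keys_add_nat)
    have disj: "A \<inter> B = {}" by (auto simp: B_def)
    have AB: "A \<subseteq> \<Delta>" "B \<subseteq> \<Delta>" using A V\<Delta> by (auto simp: B_def)
    have memE: "m \<in> E \<longleftrightarrow> m \<in> exps {0..n} \<and> (?G m \<notin> \<Delta> \<or> (i \<in> Poly_Mapping.keys m \<and> ?G m \<in> A) \<or>
        (0 \<in> Poly_Mapping.keys m \<and> ?G m \<in> B))" for m
      by (simp add: E_def)
    have mem_add: "m + Poly_Mapping.single s 1 \<in> E \<longleftrightarrow> m \<in> exps {0..n} \<and>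
        (?G m \<notin> \<Delta> \<or> (s = i \<or> i \<in> Poly_Mapping.keys m) \<and> ?G m \<in> A \<or>
          (s = 0 \<or> 0 \<in> Poly_Mapping.keys m) \<and> ?G m \<in> B)" if s: "s = 0 \<or> s = i" for m s
    proof -
      have "Poly_Mapping.single s 1 \<in> exps {0..n}" using s i by (auto simp: exps_def)
      moreover have "insert s K - {0, i} = K - {0, i}" for K using s by auto
      ultimately show ?thesis unfolding memE exps_add_iff k_add by auto
    qed
    have 1: "Poly_Mapping.lookup f m = 0" if "m \<in> {m. m \<notin> E \<and> ?G m \<notin> B}" for m
      using f(2) i0[symmetric] _ _ that
    proof (rule lookup_eq_zero_of_diff_mult)
      fix m assume "m \<in> {m. m \<notin> E \<and> ?G m \<notin> B}"
      thus "m + Poly_Mapping.single 0 1 \<notin> E"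
        using i0 unfolding mem_Collect_eq mem_add[OF disjI1[OF refl]] unfolding memE by blast
    next
      fix m assume "m + Poly_Mapping.single i 1 \<in> {m. m \<notin> E \<and> ?G m \<notin> B}"
      thus "m + Poly_Mapping.single 0 1 \<in> {m. m \<notin> E \<and> ?G m \<notin> B}"
        unfolding mem_Collect_eq mem_add[OF disjI1[OF refl]] mem_add[OF disjI2[OF refl]]
          G_add[OF disjI1[OF refl]] G_add[OF disjI2[OF refl]] by blast
    qed
    have "(X i - X 0) * f = - ((X 0 - X i) * f)" by (simp add: algebra_simps)
    hence f': "(X i - X 0) * f \<in> polys E" using polys_uminus[OF f(2)] by simp
    have 2: "Poly_Mapping.lookup f m = 0" if "m \<in> {m. m \<notin> E \<and> ?G m \<in> B}" for m
      using f' i0 _ _ that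
    proof (rule lookup_eq_zero_of_diff_mult)
      fix m assume "m \<in> {m. m \<notin> E \<and> ?G m \<in> B}"
      thus "m + Poly_Mapping.single i 1 \<notin> E"
        using i0 disj AB unfolding mem_Collect_eq mem_add[OF disjI2[OF refl]] unfolding memE by blast
    next
      fix m assume "m + Poly_Mapping.single 0 1 \<in> {m. m \<notin> E \<and> ?G m \<in> B}"
      thus "m + Poly_Mapping.single i 1 \<in> {m. m \<notin> E \<and> ?G m \<in> B}"
        using disj unfolding mem_Collect_eq mem_add[OF disjI1[OF refl]] mem_add[OF disjI2[OF refl]]
          G_add[OF disjI1[OF refl]] G_add[OF disjI2[OF refl]] by blast
    qed
    show ?thesis using 1 2 unfolding polys_def by (auto simp: in_keys_iff)
  qed
  ultimately show ?thesis unfolding separation_iff[OF \<Delta> i] using up by blast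
qed

section \<open>Homomorphisms of degree \<open>-\<epsilon>\<^sub>i\<close>\<close>

declare One_nat_def [simp del]

section \<open>Cosets modulo an ideal\<close>

lemma poly_coset_eq_iff:
  fixes a b :: "'k::field mpoly"
  assumes "ideal I (poly_ring V)" "a \<in> polys (exps V)" "b \<in> polys (exps V)"
  shows "I +>\<^bsub>poly_ring V\<^esub> a = I +>\<^bsub>poly_ring V\<^esub> b \<longleftrightarrow> a - b \<in> I"
  using ring.quotient_eq_iff_same_a_r_cos[OF cring.axioms(1)[OF cring_poly_ring] assms(1), of a b] assms(2,3)
  by (simp add: a_minus_def a_inv_poly_ring)

lemma poly_Quot_simps:
  fixes a b :: "'k::field mpoly"
  assumes "ideal I (poly_ring V)" "a \<in> polys (exps V)" "b \<in> polys (exps V)"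
  shows "(I +>\<^bsub>poly_ring V\<^esub> a) \<oplus>\<^bsub>poly_ring V Quot I\<^esub> (I +>\<^bsub>poly_ring V\<^esub> b) = I +>\<^bsub>poly_ring V\<^esub> (a + b)"
    and "(I +>\<^bsub>poly_ring V\<^esub> a) \<otimes>\<^bsub>poly_ring V Quot I\<^esub> (I +>\<^bsub>poly_ring V\<^esub> b) = I +>\<^bsub>poly_ring V\<^esub> (a * b)"
proof -
  interpret ideal I "poly_ring V" by (rule assms(1))
  show "(I +>\<^bsub>poly_ring V\<^esub> a) \<oplus>\<^bsub>poly_ring V Quot I\<^esub> (I +>\<^bsub>poly_ring V\<^esub> b) = I +>\<^bsub>poly_ring V\<^esub> (a + b)"
    using a_rcos_sum[of a b] assms by (simp add: FactRing_def)
  show "(I +>\<^bsub>poly_ring V\<^esub> a) \<otimes>\<^bsub>poly_ring V Quot I\<^esub> (I +>\<^bsub>poly_ring V\<^esub> b) = I +>\<^bsub>poly_ring V\<^esub> (a * b)"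
    using rcoset_mult_add[of a b] assms by (simp add: FactRing_def)
qed

lemma carrier_poly_Quot: "carrier (poly_ring V Quot I) = (\<lambda>a. I +>\<^bsub>poly_ring V\<^esub> a) ` polys (exps V)"
  unfolding FactRing_def A_RCOSETS_defs a_r_coset_def[symmetric] by auto

section \<open>Derivations and vanishing components of the cokernel\<close>

lemma Der_zero: "(\<lambda>f\<in>polys (exps {1..n}). 0) \<in> (Der n :: ('k::field mpoly \<Rightarrow> 'k mpoly) set)"
  by (auto simp: Der_def polys_add polys_exps_mult Const_mult_in_polys_exps)

text \<open>With \<open>Der_zero\<close> this makes the image of \<open>delta_star\<close> a
  subgroup. The restrictions to the carrier keep the maps extensional, as \<open>Der n\<close>
  demands.\<close>

lemma Der_linear_combination:
  fixes D D' :: "'k::field mpoly \<Rightarrow> 'k mpoly"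
  assumes "D \<in> Der n" "D' \<in> Der n"
  shows "(\<lambda>f\<in>polys (exps {1..n}). D f + D' f) \<in> Der n"
    and "(\<lambda>f\<in>polys (exps {1..n}). D f - D' f) \<in> Der n"
  using assms Const_mult_in_polys_exps[where V = "{1..n}" and ?'k = 'k]
  by (auto simp: Der_def polys_add polys_exps_mult algebra_simps
      intro!: polys_add polys_diff)

lemma image_eq_singleton_iff: "A \<noteq> {} \<Longrightarrow> g ` A = {b} \<longleftrightarrow> (\<forall>a\<in>A. g a = b)"
  by auto

text \<open>A class vanishes exactly when its representative lies in the image of
  \<open>delta_star\<close>. The hypothesis \<open>ne\<close> excludes an empty component, which
  would differ from the zero component.\<close>

lemma T1_component_eq_zero_iff:
  fixes I :: "'k::field mpoly set"
  assumes I: "ideal I (poly_S n)" and ne: "Hom_component n I c \<noteq> {}"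
  shows "T1_component n I c = {\<zero>\<^bsub>T1 n I\<^esub>} \<longleftrightarrow> Hom_component n I c \<subseteq> delta_star n I ` Der n"
proof -
  interpret ideal I "poly_S n" by (rule I)
  let ?B = "delta_star n I ` Der n" and ?add = "\<lambda>\<phi> \<psi>. \<lambda>f\<in>I. \<phi> f \<oplus>\<^bsub>poly_S n Quot I\<^esub> \<psi> f"
  have IS: "f \<in> polys (exps {1..n})" if "f \<in> I" for f using a_Hcarr[OF that] by simp
  have DS: "D f \<in> polys (exps {1..n})" if "D \<in> Der n" "f \<in> I" for D and f :: "'k mpoly"
    using that IS[OF that(2)] by (auto simp: Der_def)
  have coset: "?B +>\<^bsub>Hom_module n I\<^esub> \<phi> = {?add b \<phi> | b. b \<in> ?B}" for \<phi>
    by (auto simp: a_r_coset_def' Hom_module_def)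
  have zero: "\<zero>\<^bsub>T1 n I\<^esub> = ?B" by (simp add: T1_def quotient_module_def)
  have add_delta: "?add (delta_star n I D) (delta_star n I D') = delta_star n I D''"
    if "D \<in> Der n" "D' \<in> Der n" "\<And>f. f \<in> I \<Longrightarrow> D'' f = D f + D' f" for D D' D''
    unfolding delta_star_def using that DS by (auto simp: poly_Quot_simps[OF I] fun_eq_iff restrict_def)
  have "?B +>\<^bsub>Hom_module n I\<^esub> \<phi> = ?B \<longleftrightarrow> \<phi> \<in> ?B" if \<phi>: "\<phi> \<in> Hom_component n I c" for \<phi>
  proof
    assume eq: "?B +>\<^bsub>Hom_module n I\<^esub> \<phi> = ?B"
    \<comment> \<open>Adding the image of the zero derivation exhibits \<open>\<phi>\<close> as a
      member of its own coset.\<close>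
    let ?z = "delta_star n I (\<lambda>f\<in>polys (exps {1..n}). 0)"
    have "?add ?z \<phi> = \<phi>"
    proof
      fix f show "?add ?z \<phi> f = \<phi> f"
      proof (cases "f \<in> I")
        case True
        have "\<phi> f \<in> carrier (poly_S n Quot I)" using \<phi> True by (auto simp: Hom_component_def Hom_carrier_def)
        then obtain a where "a \<in> polys (exps {1..n})" "\<phi> f = I +>\<^bsub>poly_S n\<^esub> a"
          unfolding carrier_poly_Quot by blast
        thus ?thesis using True IS[OF True] by (simp add: delta_star_def poly_Quot_simps[OF I])
      next
        case False
        thus ?thesis using \<phi> by (auto simp: Hom_component_def Hom_carrier_def PiE_def extensional_def)
      qed
    qed
    moreover have "?add ?z \<phi> \<in> ?B" using eq Der_zero unfolding coset by blast
    ultimately show "\<phi> \<in> ?B" by simp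
  next
    assume "\<phi> \<in> ?B"
    then obtain D where D: "D \<in> Der n" "\<phi> = delta_star n I D" by blast
    show "?B +>\<^bsub>Hom_module n I\<^esub> \<phi> = ?B"
    proof (intro equalityI subsetI)
      fix \<psi> assume "\<psi> \<in> ?B +>\<^bsub>Hom_module n I\<^esub> \<phi>"
      then obtain D' where D': "D' \<in> Der n" "\<psi> = ?add (delta_star n I D') \<phi>" unfolding coset by blast
      hence "\<psi> = delta_star n I (\<lambda>f\<in>polys (exps {1..n}). D' f + D f)"
        unfolding D'(2) D(2) using D IS by (intro add_delta) auto
      thus "\<psi> \<in> ?B" using Der_linear_combination(1)[OF D'(1) D(1)] by blast
    next
      fix \<psi> assume "\<psi> \<in> ?B"
      then obtain D' where D': "D' \<in> Der n" "\<psi> = delta_star n I D'" by blast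
      let ?D = "\<lambda>f\<in>polys (exps {1..n}). D' f - D f"
      have "?D \<in> Der n" by (rule Der_linear_combination(2)[OF D'(1) D(1)])
      moreover from this have "\<psi> = ?add (delta_star n I ?D) \<phi>"
        unfolding D'(2) D(2) using D IS by (intro add_delta[symmetric]) auto
      ultimately show "\<psi> \<in> ?B +>\<^bsub>Hom_module n I\<^esub> \<phi>" unfolding coset by blast
    qed
  qed
  hence "(\<forall>\<phi>\<in>Hom_component n I c. ?B +>\<^bsub>Hom_module n I\<^esub> \<phi> = ?B) \<longleftrightarrow> Hom_component n I c \<subseteq> ?B"
    by (simp add: subset_eq)
  thus ?thesis unfolding T1_component_def zero image_eq_singleton_iff[OF ne] .
qed

text \<open>Every homomorphism \<open>I\<^sub>\<Delta> \<rightarrow> K[\<Delta>]\<close> of degree \<open>-\<epsilon>\<^sub>i\<close> is induced by a map of this form, which sends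
  \<open>x\<^sub>i * x\<^sup>k\<close> to \<open>\<mu> k * x\<^sup>k\<close>. The choice \<open>\<mu> k = k\<^sub>i + 1\<close> gives \<open>\<partial>/\<partial>x\<^sub>i\<close>.\<close>

definition shift :: "nat \<Rightarrow> ((nat \<Rightarrow>\<^sub>0 nat) \<Rightarrow> 'k) \<Rightarrow> 'k::field mpoly \<Rightarrow> 'k mpoly"
  where "shift i \<mu> f = Abs_poly_mapping (\<lambda>k. \<mu> k * Poly_Mapping.lookup f (k + Poly_Mapping.single i 1))"

text \<open>Translation by the exponent of \<open>x_i\<close> is injective, so the coefficient
  function under \<open>Abs_poly_mapping\<close> has finite support.\<close>

lemma lookup_shift:
  "Poly_Mapping.lookup (shift i \<mu> f) k = \<mu> k * Poly_Mapping.lookup f (k + Poly_Mapping.single i 1)"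
proof -
  have "inj (\<lambda>k :: nat \<Rightarrow>\<^sub>0 nat. k + Poly_Mapping.single i 1)" by (simp add: inj_on_def)
  hence "finite ((\<lambda>k. k + Poly_Mapping.single i 1) -` Poly_Mapping.keys f)"
    by (intro finite_vimageI) auto
  hence "finite {k. \<mu> k * Poly_Mapping.lookup f (k + Poly_Mapping.single i 1) \<noteq> 0}"
    by (rule rev_finite_subset) (auto simp: in_keys_iff)
  thus ?thesis unfolding shift_def by (subst lookup_Abs_poly_mapping) auto
qed

lemma shift_add: "shift i \<mu> (f + g) = shift i \<mu> f + shift i \<mu> g"
  by (rule poly_mapping_eqI) (simp add: lookup_shift lookup_add algebra_simps)

lemma shift_zero: "shift i \<mu> 0 = 0"
  by (rule poly_mapping_eqI) (simp add: lookup_shift)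

lemma shift_single: "shift i \<mu> (Poly_Mapping.single (k + Poly_Mapping.single i 1) c) = Poly_Mapping.single k (\<mu> k * c)"
  by (rule poly_mapping_eqI) (auto simp: lookup_shift lookup_single when_def)

lemma shift_single_0: "i \<notin> Poly_Mapping.keys m \<Longrightarrow> shift i \<mu> (Poly_Mapping.single m c) = 0"
  by (rule poly_mapping_eqI) (auto simp: lookup_shift lookup_single when_def keys_add_nat)

lemma shift_in_polys:
  assumes "f \<in> polys (exps V)"
  shows "shift i \<mu> f \<in> polys (exps V)"
  unfolding polys_def
proof (intro CollectI subsetI)
  fix k assume "k \<in> Poly_Mapping.keys (shift i \<mu> f)"
  hence "k + Poly_Mapping.single i 1 \<in> Poly_Mapping.keys f" by (auto simp: in_keys_iff lookup_shift)
  hence "k + Poly_Mapping.single i 1 \<in> exps V" using assms by (auto simp: polys_def)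
  thus "k \<in> exps V" by (simp add: exps_add_iff)
qed

section \<open>Partial derivatives\<close>

text \<open>The argument \<open>k\<close> is the exponent after differentiation, hence the
  \<open>+ 1\<close>; \<open>partial i c\<close> is \<open>c\<close> times the partial derivative by
  \<open>x_i\<close>.\<close>

definition deriv_weight :: "nat \<Rightarrow> 'k::field \<Rightarrow> (nat \<Rightarrow>\<^sub>0 nat) \<Rightarrow> 'k"
  where "deriv_weight i c k = c * of_nat (Poly_Mapping.lookup k i + 1)"

abbreviation partial :: "nat \<Rightarrow> 'k::field \<Rightarrow> 'k mpoly \<Rightarrow> 'k mpoly"
  where "partial i c \<equiv> shift i (deriv_weight i c)"

lemma partial_mult_single:
  "partial i c (Poly_Mapping.single a x * Poly_Mapping.single b y) =
    Poly_Mapping.single a x * partial i c (Poly_Mapping.single b y) +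
    Poly_Mapping.single b y * partial i c (Poly_Mapping.single a x)"
proof (cases "i \<in> Poly_Mapping.keys a"; cases "i \<in> Poly_Mapping.keys b")
  assume "i \<in> Poly_Mapping.keys a" "i \<in> Poly_Mapping.keys b"
  then obtain a' b' where a: "a = a' + Poly_Mapping.single i 1" and b: "b = b' + Poly_Mapping.single i 1"
    by (metis single_add_sub)
  let ?k = "a' + b' + Poly_Mapping.single i 1"
  have eq: "a' + Poly_Mapping.single i 1 + (b' + Poly_Mapping.single i 1) = ?k + Poly_Mapping.single i 1"
    "a' + Poly_Mapping.single i 1 + b' = ?k" "b' + Poly_Mapping.single i 1 + a' = ?k"
    by (simp_all add: algebra_simps)
  \<comment> \<open>With \<open>a'_i\<close> and \<open>b'_i\<close> the exponents of
    \<open>x_i\<close>, the factor on the left is \<open>a'_i + b'_i + 2\<close>, the sum of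
    \<open>a'_i + 1\<close> and \<open>b'_i + 1\<close>.\<close>
  have "deriv_weight i c ?k * (x * y) = x * (deriv_weight i c b' * y) + y * (deriv_weight i c a' * x)"
    by (simp add: deriv_weight_def lookup_add algebra_simps)
  thus ?thesis
    unfolding a b mult_single shift_single eq by (simp add: single_add)
next
  assume "i \<in> Poly_Mapping.keys a" and b: "i \<notin> Poly_Mapping.keys b"
  then obtain a' where a: "a = a' + Poly_Mapping.single i 1" by (metis single_add_sub)
  have eq: "a' + Poly_Mapping.single i 1 + b = a' + b + Poly_Mapping.single i 1" by (simp add: algebra_simps)
  have "Poly_Mapping.lookup b i = 0" using b by (simp add: in_keys_iff)
  thus ?thesis
    unfolding a mult_single eq shift_single shift_single_0[OF b] by (simp add: deriv_weight_def algebra_simps lookup_add)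
next
  assume a: "i \<notin> Poly_Mapping.keys a" and "i \<in> Poly_Mapping.keys b"
  then obtain b' where b: "b = b' + Poly_Mapping.single i 1" by (metis single_add_sub)
  have eq: "a + (b' + Poly_Mapping.single i 1) = a + b' + Poly_Mapping.single i 1" by (simp add: algebra_simps)
  have "Poly_Mapping.lookup a i = 0" using a by (simp add: in_keys_iff)
  thus ?thesis
    unfolding b mult_single eq shift_single shift_single_0[OF a] by (simp add: deriv_weight_def algebra_simps lookup_add)
next
  assume a: "i \<notin> Poly_Mapping.keys a" and b: "i \<notin> Poly_Mapping.keys b"
  hence "i \<notin> Poly_Mapping.keys (a + b)" by (simp add: keys_add_nat)
  thus ?thesis by (simp add: mult_single shift_single_0[OF a] shift_single_0[OF b] shift_single_0 del: One_nat_def)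
qed

text \<open>Both sides are additive in \<open>f\<close> and in \<open>g\<close>, so the Leibniz rule
  for terms suffices.\<close>

lemma partial_mult: "partial i c (f * g) = f * partial i c g + g * partial i c f"
proof -
  have single: "partial i c (Poly_Mapping.single a x * g) =
      Poly_Mapping.single a x * partial i c g + g * partial i c (Poly_Mapping.single a x)" for a x
  proof -
    have "g \<in> polys UNIV" by (simp add: polys_def)
    thus ?thesis
    proof (induction g rule: poly_keys_induct)
      case (add m c g)
      thus ?case by (simp only: distrib_left distrib_right shift_add partial_mult_single) (simp add: algebra_simps)
    qed (simp add: shift_zero)
  qed
  have "f \<in> polys UNIV" by (simp add: polys_def)
  thus ?thesis
  proof (induction f rule: poly_keys_induct)
    case (add m c f)
    thus ?case by (simp only: distrib_left distrib_right shift_add single) (simp add: algebra_simps)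
  qed (simp add: shift_zero)
qed

lemma shift_Const_mult: "shift i \<mu> (Const c * f) = Const c * shift i \<mu> f"
proof (rule poly_mapping_eqI)
  fix k
  have "Poly_Mapping.lookup (Const c * g) k = c * Poly_Mapping.lookup g k" for g and k
    using lookup_single_times_add[of 0 c g k] by (simp add: Const_def)
  thus "Poly_Mapping.lookup (shift i \<mu> (Const c * f)) k = Poly_Mapping.lookup (Const c * shift i \<mu> f) k"
    by (simp add: lookup_shift)
qed

lemma partial_Der: "(\<lambda>f\<in>polys (exps {1..n}). partial i c f) \<in> Der n"
  unfolding Der_def
  by (auto simp: polys_add polys_exps_mult Const_mult_in_polys_exps shift_in_polys shift_add
      shift_Const_mult partial_mult)

section \<open>Homomorphisms from functions on the vertices\<close>

text \<open>The default 0 is harmless modulo the ideal: if \<open>x_i * x^k\<close> lies in it and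
  the support of \<open>k\<close> is not a vertex, then \<open>x^k\<close> lies in it too.\<close>

definition weight :: "nat \<Rightarrow> nat set set \<Rightarrow> (nat set \<Rightarrow> 'k) \<Rightarrow> (nat \<Rightarrow>\<^sub>0 nat) \<Rightarrow> 'k::field"
  where "weight i \<Delta> w k = (if Poly_Mapping.keys k \<in> G_vertices i \<Delta> then w (Poly_Mapping.keys k) else 0)"

lemma SR_exps_add: "simplicial_complex n \<Delta> \<Longrightarrow> m \<in> SR_exps n \<Delta> \<Longrightarrow> b \<in> exps {1..n} \<Longrightarrow> b + m \<in> SR_exps n \<Delta>"
  using SR_exps_up_closed[of n \<Delta>] by (auto simp: up_closed_def add.commute)

text \<open>Linearity over the polynomial ring modulo the ideal, checked on terms. The two sides can
  differ only at monomials of the ideal, because \<open>w\<close> agrees on nested vertices.\<close>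

lemma shift_weight_mult:
  fixes f :: "'k::field mpoly"
  assumes \<Delta>: "simplicial_complex n \<Delta>"
    and w: "\<And>F G. F \<in> G_vertices i \<Delta> \<Longrightarrow> G \<in> G_vertices i \<Delta> \<Longrightarrow> F \<subseteq> G \<Longrightarrow> w F = w G"
    and s: "s \<in> polys (exps {1..n})" and f: "f \<in> polys (SR_exps n \<Delta>)"
  shows "shift i (weight i \<Delta> w) (s * f) - s * shift i (weight i \<Delta> w) f \<in> polys (SR_exps n \<Delta>)"
proof -
  let ?D = "shift i (weight i \<Delta> w)"
  have down: "\<And>A B. A \<in> \<Delta> \<Longrightarrow> B \<subseteq> A \<Longrightarrow> B \<in> \<Delta>" using \<Delta> unfolding simplicial_complex_def by blast
  have single: "?D (Poly_Mapping.single b c * Poly_Mapping.single m x) -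
      Poly_Mapping.single b c * ?D (Poly_Mapping.single m x) \<in> polys (SR_exps n \<Delta>)"
    if b: "b \<in> exps {1..n}" and m: "m \<in> SR_exps n \<Delta>" for b m and c x :: 'k
  proof (cases "i \<in> Poly_Mapping.keys m")
    case True
    then obtain m' where m': "m = m' + Poly_Mapping.single i 1" by (metis single_add_sub)
    have eq: "b + (m' + Poly_Mapping.single i 1) = b + m' + Poly_Mapping.single i 1" by (simp add: algebra_simps)
    \<comment> \<open>If the support of \<open>b + m'\<close> is a face, then it and the support of
      \<open>m'\<close> are nested vertices, so the weights agree.\<close>
    have "b + m' \<in> SR_exps n \<Delta> \<or> weight i \<Delta> w (b + m') = weight i \<Delta> w m'"
    proof (cases "Poly_Mapping.keys (b + m') \<in> \<Delta>")
      case False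
      thus ?thesis using b m unfolding m' by (simp add: SR_exps_def exps_add_iff)
    next
      case True
      hence m\<Delta>: "Poly_Mapping.keys m' \<in> \<Delta>" using down[OF True] by (simp add: keys_add_nat)
      have km: "Poly_Mapping.keys m' \<union> {i} \<notin> \<Delta>" using m unfolding m' SR_exps_def by (simp add: keys_add_nat)
      hence "i \<notin> Poly_Mapping.keys m'" using m\<Delta> by (auto simp: insert_absorb)
      hence V: "Poly_Mapping.keys m' \<in> G_vertices i \<Delta>" using m\<Delta> km by (simp add: G_vertices_def)
      moreover have sub: "Poly_Mapping.keys m' \<subseteq> Poly_Mapping.keys (b + m')" by (simp add: keys_add_nat)
      ultimately have "Poly_Mapping.keys (b + m') \<in> G_vertices i \<Delta>" using G_vertices_mono[OF \<Delta>] True by blast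
      thus ?thesis using V w[OF V _ sub] by (simp add: weight_def)
    qed
    hence "Poly_Mapping.single (b + m') ((weight i \<Delta> w (b + m') - weight i \<Delta> w m') * (c * x)) \<in> polys (SR_exps n \<Delta>)"
      by (auto simp: single_in_polys_iff)
    thus ?thesis unfolding m' mult_single eq shift_single
      by (simp add: algebra_simps single_diff[symmetric])
  next
    case False
    show ?thesis
    proof (cases "i \<in> Poly_Mapping.keys b")
      case True
      then obtain b' where b': "b = b' + Poly_Mapping.single i 1" by (metis single_add_sub)
      have eq: "b' + Poly_Mapping.single i 1 + m = b' + m + Poly_Mapping.single i 1" by (simp add: algebra_simps)
      \<comment> \<open>The factor \<open>x_i\<close> comes from \<open>b\<close>, so lowering it
        leaves a multiple of \<open>x^m\<close>.\<close>
      have "b' + m \<in> SR_exps n \<Delta>" using b m SR_exps_add[OF \<Delta>] unfolding b' exps_add_iff by blast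
      thus ?thesis unfolding b' mult_single eq shift_single shift_single_0[OF False]
        by (simp add: single_in_polys)
    next
      case b: False
      hence "i \<notin> Poly_Mapping.keys (b + m)" using False by (simp add: keys_add_nat)
      thus ?thesis unfolding mult_single by (simp add: shift_single_0 False)
    qed
  qed
  have single': "?D (Poly_Mapping.single b c * f) - Poly_Mapping.single b c * ?D f \<in> polys (SR_exps n \<Delta>)"
    if b: "b \<in> exps {1..n}" for b c
    using f
  proof (induction f rule: poly_keys_induct)
    case (add m x f)
    from polys_add[OF single[OF b add(1), of c x] add(3)] show ?case
      by (simp add: shift_add algebra_simps)
  qed (simp add: shift_zero)
  show ?thesis
    using s
  proof (induction s rule: poly_keys_induct)
    case (add b c s)
    from polys_add[OF single'[OF add(1), of c] add(3)] show ?case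
      by (simp add: shift_add algebra_simps)
  qed (simp add: shift_zero)
qed

text \<open>Supplies the homomorphisms: \<open>shift_weight_mult\<close> gives linearity, and
  \<open>shift\<close> lowers the exponent of \<open>x_i\<close> by one.\<close>

lemma shift_weight_Hom_component:
  fixes w :: "nat set \<Rightarrow> 'k::field"
  assumes \<Delta>: "simplicial_complex n \<Delta>" and i: "i \<in> {1..n}"
    and w: "\<And>F G. F \<in> G_vertices i \<Delta> \<Longrightarrow> G \<in> G_vertices i \<Delta> \<Longrightarrow> F \<subseteq> G \<Longrightarrow> w F = w G"
  defines "I \<equiv> polys (SR_exps n \<Delta>) :: 'k mpoly set"
  shows "(\<lambda>f\<in>I. I +>\<^bsub>poly_S n\<^esub> shift i (weight i \<Delta> w) f) \<in> Hom_component n I (- unit_vec i)"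
proof -
  let ?D = "shift i (weight i \<Delta> w)"
  have I: "ideal I (poly_S n)" unfolding I_def by (rule polys_ideal[OF SR_exps_up_closed[OF \<Delta>]])
  have IS: "f \<in> polys (exps {1..n})" if "f \<in> I" for f
    using that by (auto simp: I_def polys_def SR_exps_def)
  have closed: "f + g \<in> I" if "f \<in> I" "g \<in> I" for f g
    using that unfolding I_def by (rule polys_add)
  have closed': "s * f \<in> I" if "f \<in> I" "s \<in> polys (exps {1..n})" for f s
    using that ideal.I_l_closed[OF I, of f s] by simp
  have S: "s * f \<in> polys (exps {1..n})" if "f \<in> polys (exps {1..n})" "s \<in> polys (exps {1..n})" for f s :: "'k mpoly"
    using polys_mult[OF exps_add that(2,1)] by simp
  have "I +>\<^bsub>poly_S n\<^esub> ?D (s * f) = I +>\<^bsub>poly_S n\<^esub> (s * ?D f)"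
    if "f \<in> I" "s \<in> polys (exps {1..n})" for f s
  proof (subst poly_coset_eq_iff[OF I])
    show "?D (s * f) - s * ?D f \<in> I"
      using that unfolding I_def by (intro shift_weight_mult[OF \<Delta>] w)
  qed (use that IS[OF that(1)] in \<open>auto intro!: shift_in_polys S\<close>)
  hence "(\<lambda>f\<in>I. I +>\<^bsub>poly_S n\<^esub> ?D f) \<in> Hom_carrier n I"
    unfolding Hom_carrier_def
    by (auto simp: carrier_poly_Quot poly_Quot_simps[OF I] IS closed closed' shift_in_polys shift_add)
  moreover have "?D f \<in> S_component n (\<lambda>j. a j + (- unit_vec i) j)" if f: "f \<in> S_component n a" for f a
    unfolding S_component_def
  proof (intro CollectI conjI ballI)
    show "?D f \<in> carrier (poly_S n)" using f shift_in_polys[of f "{1..n}"] by (simp add: S_component_def)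
    fix k j assume k: "k \<in> Poly_Mapping.keys (?D f)" and j: "j \<in> {1..n}"
    have "k + Poly_Mapping.single i 1 \<in> Poly_Mapping.keys f" using k by (auto simp: in_keys_iff lookup_shift)
    hence "int (Poly_Mapping.lookup (k + Poly_Mapping.single i 1) j) = a j" using f j unfolding S_component_def by blast
    thus "int (Poly_Mapping.lookup k j) = a j + (- unit_vec i) j"
      by (auto simp: lookup_add lookup_single unit_vec_def when_def split: if_splits)
  qed
  ultimately show ?thesis unfolding Hom_component_def Quot_component_def by auto
qed

section \<open>Connectedness and the component of \<open>T^1\<close> in degree
  \<open>-e_i\<close>\<close>

text \<open>The indicator function of a component gives a homomorphism, whereas any derivation
  \<open>D\<close> yields the same scalar at all vertices, namely the constant term of
  \<open>D (X i)\<close>.\<close>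

lemma T1_component_zero_imp_connected:
  fixes \<Delta> :: "nat set set"
  assumes \<Delta>: "simplicial_complex n \<Delta>" and i: "i \<in> {1..n}"
    and sub: "Hom_component n (polys (SR_exps n \<Delta>)) (- unit_vec i) \<subseteq>
      delta_star n (polys (SR_exps n \<Delta>) :: 'k::field mpoly set) ` Der n"
  shows "graph_connected (G_graph i \<Delta>)"
proof (rule ccontr)
  let ?I = "polys (SR_exps n \<Delta>) :: 'k mpoly set"
  assume disconn: "\<not> graph_connected (G_graph i \<Delta>)"
  then obtain A u v where A: "A \<subseteq> G_vertices i \<Delta>" and uv: "u \<in> A" "v \<in> G_vertices i \<Delta>" "v \<notin> A"
    and edge: "\<And>F G. F \<in> G_vertices i \<Delta> \<Longrightarrow> G \<in> G_vertices i \<Delta> \<Longrightarrow> F \<subseteq> G \<Longrightarrow> F \<in> A \<longleftrightarrow> G \<in> A"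
    using G_graph_disconnected_cut[OF disconn] by metis
  define w :: "nat set \<Rightarrow> 'k" where "w = (\<lambda>F. if F \<in> A then 1 else 0)"
  let ?D = "shift i (weight i \<Delta> w)"
  have "(\<lambda>f\<in>?I. ?I +>\<^bsub>poly_S n\<^esub> ?D f) \<in> Hom_component n ?I (- unit_vec i)"
  proof (rule shift_weight_Hom_component[OF \<Delta> i])
    show "w F = w G" if "F \<in> G_vertices i \<Delta>" "G \<in> G_vertices i \<Delta>" "F \<subseteq> G" for F G
      unfolding w_def edge[OF that] ..
  qed
  hence "(\<lambda>f\<in>?I. ?I +>\<^bsub>poly_S n\<^esub> ?D f) \<in> delta_star n ?I ` Der n"
    using sub by (rule rev_subsetD)
  then obtain D where eq: "(\<lambda>f\<in>?I. ?I +>\<^bsub>poly_S n\<^esub> ?D f) = delta_star n ?I D" and D: "D \<in> Der n"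
    by (rule imageE)
  have I: "ideal ?I (poly_S n)" by (rule polys_ideal[OF SR_exps_up_closed[OF \<Delta>]])
  have "w F = Poly_Mapping.lookup (D (X i)) 0" if F: "F \<in> G_vertices i \<Delta>" for F
  proof -
    note P = G_vertices_props[OF \<Delta> F]
    let ?m = "sq F + Poly_Mapping.single i 1"
    have kF: "Poly_Mapping.keys (sq F) = F" by (rule keys_sq[OF P(2)])
    have FS: "sq F \<in> exps {1..n}" "Poly_Mapping.single i 1 \<in> exps {1..n}"
      using P i by (auto simp: exps_def kF)
    have m: "?m \<in> SR_exps n \<Delta>"
      using F FS by (simp add: SR_exps_def exps_add_iff keys_add_nat kF G_vertices_def)
    have S: "Poly_Mapping.single (sq F) 1 \<in> (polys (exps {1..n}) :: 'k mpoly set)" "X i \<in> (polys (exps {1..n}) :: 'k mpoly set)"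
      using FS by (auto simp: X_def intro!: single_in_polys)
    have f: "Poly_Mapping.single ?m 1 \<in> ?I" using m by (rule single_in_polys)
    hence fS: "Poly_Mapping.single ?m 1 \<in> (polys (exps {1..n}) :: 'k mpoly set)"
      by (auto simp: single_in_polys_iff SR_exps_def)
    have DS: "D g \<in> polys (exps {1..n})" if "g \<in> polys (exps {1..n})" for g
      using D that by (auto simp: Der_def)
    have "?I +>\<^bsub>poly_S n\<^esub> ?D (Poly_Mapping.single ?m 1) = ?I +>\<^bsub>poly_S n\<^esub> D (Poly_Mapping.single ?m 1)"
      using fun_cong[OF eq, of "Poly_Mapping.single ?m 1"] f by (simp add: delta_star_def)
    hence "?D (Poly_Mapping.single ?m 1) - D (Poly_Mapping.single ?m 1) \<in> ?I"
      using poly_coset_eq_iff[OF I shift_in_polys[OF fS] DS[OF fS]] by blast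
    \<comment> \<open>As \<open>x_F\<close> is not in the ideal, its coefficient depends only on the
      coset.\<close>
    moreover have "sq F \<notin> SR_exps n \<Delta>" using F by (simp add: SR_exps_def kF G_vertices_def)
    ultimately have "Poly_Mapping.lookup (?D (Poly_Mapping.single ?m 1) - D (Poly_Mapping.single ?m 1)) (sq F) = 0"
      by (auto simp: polys_def in_keys_iff)
    moreover have "?D (Poly_Mapping.single ?m 1) = Poly_Mapping.single (sq F) (w F)"
      unfolding shift_single using F by (simp add: weight_def kF)
    \<comment> \<open>In the Leibniz rule for \<open>x_F * x_i\<close>, the summand with factor
      \<open>x_i\<close> does not contribute at \<open>x_F\<close>, because \<open>i\<close> is not
      in \<open>F\<close>.\<close>
    moreover have "D (Poly_Mapping.single ?m 1) = Poly_Mapping.single (sq F) 1 * D (X i) + X i * D (Poly_Mapping.single (sq F) 1)"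
    proof -
      have "Poly_Mapping.single ?m 1 = Poly_Mapping.single (sq F) 1 * (X i :: 'k mpoly)"
        by (simp add: X_def mult_single)
      thus ?thesis using D S by (simp add: Der_def)
    qed
    moreover have "Poly_Mapping.lookup (X i * D (Poly_Mapping.single (sq F) 1)) (sq F) = 0"
      using P by (intro lookup_X_times_0) (simp add: kF)
    moreover have "Poly_Mapping.lookup (Poly_Mapping.single (sq F) 1 * D (X i)) (sq F) = Poly_Mapping.lookup (D (X i)) 0"
      using lookup_single_times_add[of "sq F" 1 "D (X i)" 0] by simp
    ultimately show ?thesis by (simp add: lookup_minus lookup_add)
  qed
  hence "w u = w v" using uv A by (metis subsetD)
  thus False using uv by (simp add: w_def)
qed

text \<open>The degree fixes \<open>\<phi>\<close> on monomials up to scalars, linearity relates the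
  scalars along edges, and connectedness makes them one constant \<open>c\<close>. Then
  \<open>\<phi>\<close> is induced by \<open>partial i c\<close>.\<close>

lemma connected_imp_T1_component_zero:
  fixes \<Delta> :: "nat set set"
  assumes \<Delta>: "simplicial_complex n \<Delta>" and i: "i \<in> {1..n}"
    and conn: "graph_connected (G_graph i \<Delta>)"
  shows "Hom_component n (polys (SR_exps n \<Delta>)) (- unit_vec i) \<subseteq>
      delta_star n (polys (SR_exps n \<Delta>) :: 'k::field mpoly set) ` Der n"
proof
  let ?I = "polys (SR_exps n \<Delta>) :: 'k mpoly set" and ?e = "Poly_Mapping.single i 1 :: nat \<Rightarrow>\<^sub>0 nat"
  let ?c = "\<lambda>f. ?I +>\<^bsub>poly_S n\<^esub> f"
  fix \<phi> assume \<phi>: "\<phi> \<in> Hom_component n ?I (- unit_vec i)"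
  have I: "ideal ?I (poly_S n)" by (rule polys_ideal[OF SR_exps_up_closed[OF \<Delta>]])
  have IS: "f \<in> polys (exps {1..n})" if "f \<in> ?I" for f
    using that by (auto simp: polys_def SR_exps_def)
  have ext: "\<phi> \<in> extensional ?I" and val: "\<And>f. f \<in> ?I \<Longrightarrow> \<exists>a\<in>polys (exps {1..n}). \<phi> f = ?c a"
    and add: "\<And>f g. f \<in> ?I \<Longrightarrow> g \<in> ?I \<Longrightarrow> \<phi> (f + g) = \<phi> f \<oplus>\<^bsub>poly_S n Quot ?I\<^esub> \<phi> g"
    and mult: "\<And>s f. s \<in> polys (exps {1..n}) \<Longrightarrow> f \<in> ?I \<Longrightarrow> \<phi> (s * f) = ?c s \<otimes>\<^bsub>poly_S n Quot ?I\<^esub> \<phi> f"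
    and comp: "\<And>a f. f \<in> ?I \<Longrightarrow> f \<in> S_component n a \<Longrightarrow> \<exists>h\<in>S_component n (\<lambda>j. a j + (- unit_vec i) j). \<phi> f = ?c h"
    using \<phi> unfolding Hom_component_def Hom_carrier_def carrier_poly_Quot Quot_component_def
    by (simp_all add: PiE_iff image_iff)
  have e: "?e \<in> exps {1..n}" using i by (simp add: exps_def)
  have mono: "\<exists>h. h \<in> S_component n (\<lambda>j. int (Poly_Mapping.lookup m j) + (- unit_vec i) j) \<and>
      \<phi> (Poly_Mapping.single m 1) = ?c h" if m: "m \<in> SR_exps n \<Delta>" for m
  proof -
    have "m \<in> exps {1..n}" using m by (simp add: SR_exps_def)
    hence "Poly_Mapping.single m 1 \<in> S_component n (\<lambda>j. int (Poly_Mapping.lookup m j))"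
      by (simp add: S_component_def single_in_polys)
    thus ?thesis using comp[OF single_in_polys[OF m]] by blast
  qed
  \<comment> \<open>The image would have exponent -1 in \<open>x_i\<close>, so its representative is
    zero.\<close>
  have mono0: "\<phi> (Poly_Mapping.single m 1) = ?c 0" if m: "m \<in> SR_exps n \<Delta>" "i \<notin> Poly_Mapping.keys m" for m
  proof -
    obtain h where h: "h \<in> S_component n (\<lambda>j. int (Poly_Mapping.lookup m j) + (- unit_vec i) j)"
      "\<phi> (Poly_Mapping.single m 1) = ?c h" using mono[OF m(1)] by blast
    have "k \<notin> Poly_Mapping.keys h" for k
    proof
      assume "k \<in> Poly_Mapping.keys h"
      hence "int (Poly_Mapping.lookup k i) = int (Poly_Mapping.lookup m i) + (- unit_vec i) i"
        using h(1) i unfolding S_component_def by blast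
      thus False using m(2) by (simp add: unit_vec_def in_keys_iff)
    qed
    hence "h = 0" by (intro poly_mapping_eqI) (simp add: in_keys_iff)
    thus ?thesis using h(2) by simp
  qed
  \<comment> \<open>In the degree of \<open>x^k\<close> the polynomial ring is spanned by
    \<open>x^k\<close> alone.\<close>
  have mono1: "\<exists>c. \<phi> (Poly_Mapping.single (k + ?e) 1) = ?c (Poly_Mapping.single k c)"
    if m: "k + ?e \<in> SR_exps n \<Delta>" for k
  proof -
    obtain h where h: "h \<in> S_component n (\<lambda>j. int (Poly_Mapping.lookup (k + ?e) j) + (- unit_vec i) j)"
      "\<phi> (Poly_Mapping.single (k + ?e) 1) = ?c h" using mono[OF m] by blast
    have kS: "k \<in> exps {1..n}" using m by (simp add: SR_exps_def exps_add_iff)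
    have "k' = k" if k': "k' \<in> Poly_Mapping.keys h" for k'
    proof (rule poly_mapping_eqI)
      fix j
      have "k' \<in> exps {1..n}" using h(1) k' by (auto simp: S_component_def polys_def)
      show "Poly_Mapping.lookup k' j = Poly_Mapping.lookup k j"
      proof (cases "j \<in> {1..n}")
        case True
        hence "int (Poly_Mapping.lookup k' j) = int (Poly_Mapping.lookup (k + ?e) j) + (- unit_vec i) j"
          using h(1) k' unfolding S_component_def by blast
        thus ?thesis by (auto simp: lookup_add lookup_single unit_vec_def when_def split: if_splits)
      next
        case False
        hence "j \<notin> Poly_Mapping.keys k'" "j \<notin> Poly_Mapping.keys k"
          using kS \<open>k' \<in> exps {1..n}\<close> unfolding exps_def by blast+
        thus ?thesis by (simp add: in_keys_iff)
      qed
    qed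
    hence "h = Poly_Mapping.single k (Poly_Mapping.lookup h k)"
      by (intro poly_mapping_eqI) (auto simp: lookup_single when_def in_keys_iff)
    thus ?thesis using h(2) by metis
  qed
  have VS: "sq F + ?e \<in> SR_exps n \<Delta>" "Poly_Mapping.keys (sq F) = F" "sq F \<in> exps {1..n}" if "F \<in> G_vertices i \<Delta>" for F
  proof -
    note P = G_vertices_props[OF \<Delta> that]
    show k: "Poly_Mapping.keys (sq F) = F" by (rule keys_sq[OF P(2)])
    thus S: "sq F \<in> exps {1..n}" using P by (simp add: exps_def)
    show "sq F + ?e \<in> SR_exps n \<Delta>"
      using that S e by (simp add: SR_exps_def exps_add_iff keys_add_nat k G_vertices_def)
  qed
  have "\<forall>F\<in>G_vertices i \<Delta>. \<exists>c. \<phi> (Poly_Mapping.single (sq F + ?e) 1) = ?c (Poly_Mapping.single (sq F) c)"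
    using mono1 VS(1) by blast
  then obtain l where l: "\<And>F. F \<in> G_vertices i \<Delta> \<Longrightarrow> \<phi> (Poly_Mapping.single (sq F + ?e) 1) = ?c (Poly_Mapping.single (sq F) (l F))"
    by (metis (no_types) bchoice)
  have up: "\<phi> (Poly_Mapping.single (k + ?e) 1) = ?c (Poly_Mapping.single k (l F))"
    if F: "F \<in> G_vertices i \<Delta>" and k: "k \<in> exps {1..n}" "F \<subseteq> Poly_Mapping.keys k" for k F
  proof -
    obtain d where d: "k = sq F + d" using sq_le_iff[of F k] k(2) G_vertices_props(2)[OF \<Delta> F] by blast
    have dS: "Poly_Mapping.single d 1 \<in> (polys (exps {1..n}) :: 'k mpoly set)"
      using k(1) unfolding d by (simp add: exps_add_iff single_in_polys)
    have "Poly_Mapping.single (k + ?e) (1::'k) = Poly_Mapping.single d 1 * Poly_Mapping.single (sq F + ?e) 1"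
      unfolding d by (simp add: mult_single algebra_simps)
    hence "\<phi> (Poly_Mapping.single (k + ?e) 1) = ?c (Poly_Mapping.single d 1) \<otimes>\<^bsub>poly_S n Quot ?I\<^esub> ?c (Poly_Mapping.single (sq F) (l F))"
      using mult[OF dS single_in_polys[OF VS(1)[OF F]]] l[OF F] by simp
    also have "\<dots> = ?c (Poly_Mapping.single d 1 * Poly_Mapping.single (sq F) (l F))"
      by (rule poly_Quot_simps(2)[OF I dS single_in_polys[OF VS(3)[OF F]]])
    also have "Poly_Mapping.single d 1 * Poly_Mapping.single (sq F) (l F) = Poly_Mapping.single k (l F)"
      unfolding d by (simp add: mult_single add.commute)
    finally show ?thesis .
  qed
  \<comment> \<open>Since \<open>x_i * x_G\<close> is a multiple of \<open>x_i * x_F\<close>, both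
    scalars describe its image; they agree because \<open>x_G\<close> is not in the ideal.\<close>
  have l_eq: "l F = l G" if F: "F \<in> G_vertices i \<Delta>" and G: "G \<in> G_vertices i \<Delta>" and FG: "F \<subset> G" for F G
  proof -
    have "?c (Poly_Mapping.single (sq G) (l F)) = ?c (Poly_Mapping.single (sq G) (l G))"
      using up[OF F VS(3)[OF G]] l[OF G] FG VS(2)[OF G] by auto
    hence "Poly_Mapping.single (sq G) (l F) - Poly_Mapping.single (sq G) (l G) \<in> ?I"
      using poly_coset_eq_iff[OF I single_in_polys[OF VS(3)[OF G]] single_in_polys[OF VS(3)[OF G]]] by blast
    hence "l F - l G = 0 \<or> sq G \<in> SR_exps n \<Delta>"
      by (simp add: single_diff[symmetric] single_in_polys_iff)
    moreover have "sq G \<notin> SR_exps n \<Delta>" using G VS(2)[OF G] by (simp add: SR_exps_def G_vertices_def)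
    ultimately show ?thesis by simp
  qed
  \<comment> \<open>If the graph has no vertices, any \<open>c\<close> will do.\<close>
  obtain c where c: "\<And>F. F \<in> G_vertices i \<Delta> \<Longrightarrow> l F = c"
    using graph_connected_G_graph_invariant[OF conn, of _ _ l] l_eq by metis
  let ?D = "partial i c"
  have D_mono: "\<phi> (Poly_Mapping.single m 1) = ?c (?D (Poly_Mapping.single m 1))" if m: "m \<in> SR_exps n \<Delta>" for m
  proof (cases "i \<in> Poly_Mapping.keys m")
    case False
    thus ?thesis using mono0[OF m] by (simp add: shift_single_0)
  next
    case True
    then obtain k where k: "m = k + ?e" by (rule single_add_sub)
    have kS: "k \<in> exps {1..n}" using m unfolding k by (simp add: SR_exps_def exps_add_iff)
    show ?thesis
    proof (cases "Poly_Mapping.keys k \<in> \<Delta>")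
      case False
      obtain x where x: "\<phi> (Poly_Mapping.single m 1) = ?c (Poly_Mapping.single k x)" using mono1 m unfolding k by blast
      \<comment> \<open>Here \<open>x^k\<close> is in the ideal, so both cosets are zero.\<close>
      have "k \<in> SR_exps n \<Delta>" using False kS by (simp add: SR_exps_def)
      thus ?thesis
        unfolding x unfolding k shift_single using kS
        by (subst poly_coset_eq_iff[OF I]) (auto intro!: single_in_polys simp: single_diff[symmetric])
    next
      case True
      have km: "Poly_Mapping.keys k \<union> {i} \<notin> \<Delta>" using m unfolding k SR_exps_def by (simp add: keys_add_nat)
      hence ik: "i \<notin> Poly_Mapping.keys k" using True by (auto simp: insert_absorb)
      hence V: "Poly_Mapping.keys k \<in> G_vertices i \<Delta>" using True km by (simp add: G_vertices_def)
      \<comment> \<open>At a vertex \<open>x_i\<close> does not occur in \<open>k\<close>, so the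
        weight is \<open>c * (0 + 1) = c\<close>.\<close>
      show ?thesis
        unfolding k shift_single up[OF V kS order_refl] c[OF V] using ik
        by (simp add: deriv_weight_def in_keys_iff)
    qed
  qed
  have D: "\<phi> f = ?c (?D f)" if "f \<in> ?I" for f
    using that
  proof (induction f rule: poly_keys_induct)
    case zero
    obtain a where a: "a \<in> polys (exps {1..n})" "\<phi> 0 = ?c a" using val[of 0] by auto
    \<comment> \<open>The value at 0 comes from linearity with the scalar 0.\<close>
    have "\<phi> (0 * 0) = ?c (0 * a)" using mult[of 0 0] poly_Quot_simps(2)[OF I polys_zero a(1)] a(2) by simp
    thus ?case by (simp add: shift_zero)
  next
    case (add m x f)
    have m: "Poly_Mapping.single m 1 \<in> ?I" "Poly_Mapping.single m x \<in> ?I" using add(1) by (auto intro: single_in_polys)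
    have x: "Const x \<in> (polys (exps {1..n}) :: 'k mpoly set)" unfolding Const_def by (intro single_in_polys) simp
    have eq: "Poly_Mapping.single m x = Const x * Poly_Mapping.single m 1" by (simp add: Const_def mult_single)
    have S: "?D (Poly_Mapping.single m 1) \<in> polys (exps {1..n})" "?D f \<in> polys (exps {1..n})"
      using IS[OF m(1)] IS[OF add(2)] by (auto intro: shift_in_polys)
    have S': "?D (Poly_Mapping.single m x) \<in> polys (exps {1..n})" using IS[OF m(2)] by (rule shift_in_polys)
    have "\<phi> (Poly_Mapping.single m x) = ?c (?D (Poly_Mapping.single m x))"
      unfolding eq mult[OF x m(1)] shift_Const_mult D_mono[OF add(1)] by (rule poly_Quot_simps(2)[OF I x S(1)])
    hence "\<phi> (Poly_Mapping.single m x + f) = ?c (?D (Poly_Mapping.single m x)) \<oplus>\<^bsub>poly_S n Quot ?I\<^esub> ?c (?D f)"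
      using \<open>\<And>f g. f \<in> ?I \<Longrightarrow> g \<in> ?I \<Longrightarrow> \<phi> (f + g) = \<phi> f \<oplus>\<^bsub>poly_S n Quot ?I\<^esub> \<phi> g\<close>[OF m(2) add(2)] add(3) by simp
    thus ?case unfolding shift_add poly_Quot_simps(1)[OF I S' S(2)] .
  qed
  have "\<phi> = delta_star n ?I (\<lambda>f\<in>polys (exps {1..n}). ?D f)"
  proof
    fix f show "\<phi> f = delta_star n ?I (\<lambda>f\<in>polys (exps {1..n}). ?D f) f"
      using D[of f] IS[of f] ext by (cases "f \<in> ?I") (auto simp: delta_star_def extensional_def)
  qed
  thus "\<phi> \<in> delta_star n ?I ` Der n" using partial_Der by blast
qed

theorem theorem1p8:
  fixes n :: nat and \<Delta> :: "nat set set"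
  assumes "simplicial_complex n \<Delta>"
  shows "(inseparable TYPE('k::field) n \<Delta> \<longleftrightarrow>
            (\<forall>i\<in>{1..n}. graph_connected (G_graph i \<Delta>))) \<and>
         ((\<forall>i\<in>{1..n}. graph_connected (G_graph i \<Delta>)) \<longleftrightarrow>
            (\<forall>i\<in>{1..n}. T1_component n (SR_ideal n \<Delta> :: 'k mpoly set) (- unit_vec i)
               = {\<zero>\<^bsub>T1 n (SR_ideal n \<Delta> :: 'k mpoly set)\<^esub>}))"
proof -
  let ?I = "polys (SR_exps n \<Delta>) :: 'k mpoly set"
  have I: "ideal ?I (poly_S n)" by (rule polys_ideal[OF SR_exps_up_closed[OF assms]])
  have "T1_component n ?I (- unit_vec i) = {\<zero>\<^bsub>T1 n ?I\<^esub>} \<longleftrightarrow> graph_connected (G_graph i \<Delta>)"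
    if i: "i \<in> {1..n}" for i
  proof -
    \<comment> \<open>The zero function on the vertices provides the zero homomorphism.\<close>
    have "Hom_component n ?I (- unit_vec i) \<noteq> {}"
      using shift_weight_Hom_component[OF assms i, of "\<lambda>_. 0 :: 'k"] by blast
    thus ?thesis
      using T1_component_eq_zero_iff[OF I] T1_component_zero_imp_connected[OF assms i, where ?'k = 'k]
        connected_imp_T1_component_zero[OF assms i, where ?'k = 'k] by blast
  qed
  moreover have "inseparable TYPE('k) n \<Delta> \<longleftrightarrow> (\<forall>i\<in>{1..n}. graph_connected (G_graph i \<Delta>))"
    using connected_imp_not_separation[OF assms, where ?'k = 'k] disconnected_imp_separation[OF assms, where ?'k = 'k]
    unfolding inseparable_def separable_def by blast
  ultimately show ?thesis unfolding SR_ideal_eq[OF assms] by blast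
qed

end
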